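(* Let $H$ be any graph. Then there exist constants $C > 0$ and $\gamma > 0$ such that, provided $p \geq Cn^{-1/m_2(H)}$, the random graph $G := G_{n,p}$ with probability $1 - e^{-\Theta(n^2 p)}$ satisfies the following: for every $R \subseteq E(G)$ with $|R| \le \gamma n^2 p$, Maker has a winning strategy in the $H$-game played on $E(G) \setminus R$.
   Context: $G_{n,p}$ is the binomial random graph on $n$ vertices with edge probability $p$. In the $H$-game on an edge set $E$, Maker and Breaker alternately claim previously unclaimed edges of $E$, Maker moving first, until all edges are claimed; Maker wins if his edges contain all edges of a copy of $H$, Breaker wins otherwise. For a graph $G$ with at least three vertices, $d_2(G) := (e_G - 1)/(v_G - 2)$ and $m_2(G) := \max\{d_2(J) : J \subseteq G, v_J \geq 3\}$. *)

theory Defs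
  imports "HOL-Probability.Probability" "HOL-Probability.Product_PMF"
begin

type_synonym 'a graph = "'a set \<times> 'a set set"

definition all_edges :: "'a set \<Rightarrow> 'a set set" where
  "all_edges V = {e. e \<subseteq> V \<and> card e = 2}"

definition finite_simple_graph :: "'a graph \<Rightarrow> bool" where
  "finite_simple_graph G \<longleftrightarrow> finite (fst G) \<and> snd G \<subseteq> all_edges (fst G)"

definition subgraphs :: "'a graph \<Rightarrow> 'a graph set" where
  "subgraphs G = {(W, F). W \<subseteq> fst G \<and> F \<subseteq> snd G \<and> F \<subseteq> all_edges W}"

definition d2 :: "'a graph \<Rightarrow> real" where
  "d2 G = (real (card (snd G)) - 1) / (real (card (fst G)) - 2)"

definition m2 :: "'a graph \<Rightarrow> real" where
  "m2 G = Max {d2 J | J. J \<in> subgraphs G \<and> card (fst J) \<ge> 3}"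

text \<open>The function $n^{-1/m_2(H)}$. We have $m_2(H) = 0$ exactly when $H$ has a single edge; then
  $-1/m_2(H)$ is read as $-\infty$, so that the lower bound on $p$ is void. (With the HOL convention
  \<open>1 / 0 = 0\<close> the bound would instead be the constant 1.)\<close>

definition m2_threshold :: "'a graph \<Rightarrow> nat \<Rightarrow> real" where
  "m2_threshold H n = (if m2 H = 0 then 0 else real n powr (- 1 / m2 H))"

definition Gnp :: "nat \<Rightarrow> real \<Rightarrow> nat graph pmf" where
  "Gnp n p = map_pmf (\<lambda>f. ({..<n}, {e \<in> all_edges {..<n}. f e}))
     (Pi_pmf (all_edges {..<n}) False (\<lambda>_. bernoulli_pmf p))"

definition contains_copy :: "'a graph \<Rightarrow> 'b graph \<Rightarrow> bool" where
  "contains_copy H G \<longleftrightarrow>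
     (\<exists>\<phi>. inj_on \<phi> (fst H) \<and> \<phi> ` fst H \<subseteq> fst G \<and> (\<forall>e \<in> snd H. \<phi> ` e \<in> snd G))"

text \<open>A position is the list of the elements claimed so far, in order. Maker moves first, so
  his moves are the entries at even indices. A strategy of Maker maps positions to moves; it has
  to be legal at every position in which it is Maker's turn and the board is not exhausted.\<close>

definition maker_strategy :: "'e set \<Rightarrow> ('e list \<Rightarrow> 'e) \<Rightarrow> bool" where
  "maker_strategy X \<sigma> \<longleftrightarrow>
     (\<forall>h. distinct h \<and> set h \<subset> X \<and> even (length h) \<longrightarrow> \<sigma> h \<in> X - set h)"

definition complete_play :: "'e set \<Rightarrow> 'e list \<Rightarrow> bool" where
  "complete_play X xs \<longleftrightarrow> distinct xs \<and> set xs = X"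

definition follows :: "('e list \<Rightarrow> 'e) \<Rightarrow> 'e list \<Rightarrow> bool" where
  "follows \<sigma> xs \<longleftrightarrow> (\<forall>i < length xs. even i \<longrightarrow> xs ! i = \<sigma> (take i xs))"

definition maker_claims :: "'e list \<Rightarrow> 'e set" where
  "maker_claims xs = {xs ! i | i. i < length xs \<and> even i}"

definition maker_wins_H_game :: "'a graph \<Rightarrow> 'b graph \<Rightarrow> bool" where
  "maker_wins_H_game H G \<longleftrightarrow>
     (\<exists>\<sigma>. maker_strategy (snd G) \<sigma> \<and>
        (\<forall>xs. complete_play (snd G) xs \<and> follows \<sigma> xs \<longrightarrow>
           contains_copy H (fst G, maker_claims xs)))"

end

theory Submission
  imports Defs
begin

text \<open>If Maker's edges \<open>M\<close> contain no copy of \<open>H\<close>, then by a one-step hypergraph container lemma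
  there are a small fingerprint \<open>T \<subseteq> M\<close> and a container \<open>C T \<supseteq> M\<close>, depending on \<open>T\<close> only, that misses
  a fixed proportion of the edges of the complete graph. So Maker wins as soon as he claims an edge
  outside \<open>C T\<close> for every small \<open>T\<close>, and as the hitter of the sets \<open>E(G) - R - C T\<close> he can do so, by
  Erdos and Selfridge, whenever the sum of \<open>2 ^ - |E(G) - R - C T|\<close> over the small \<open>T \<subseteq> E(G)\<close> is below 1.
  Deleting \<open>R\<close> costs a factor of at most \<open>2 ^ |R|\<close>, while in \<open>G\<^sub>n\<^sub>,\<^sub>p\<close> the expectation of the sum for
  \<open>R = {}\<close> is at most \<open>exp (- \<Omega>(n\<^sup>2 p))\<close>; Markov's inequality finishes the proof.\<close>

section \<open>Hypergraph containers\<close>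

text \<open>The density m_2(H) enters only through codegrees. With \<theta> = n^(-1/m_2(H)), the
  number of copies of H through j given edges is at most a constant times \<theta>^(j-1) times the
  average number through one edge. Under this condition fingerprints of size O(\<theta> n^2)
  suffice, and for p >= C \<theta> this is a small multiple of n^2 p.

  One container step is enough, with no iteration towards nearly H-free containers, because G must
  merely have many edges outside each container. Letting T range over subsets of E(G) only is
  essential. Counting all small T would cost a factor log(1/p) in the exponent; as T lies in G with
  probability p^|T|, the cost is the sum of p^|T| over |T| <= \<epsilon> n^2 p, which is the
  exponential of a small multiple of n^2 p.

  Hyperedges carry weights, to be read as multiplicities: several embeddings may have the same edge
  set, and several links may share an edge.\<close>

definition codegree :: "'v set \<Rightarrow> ('v set \<Rightarrow> real) \<Rightarrow> 'v set \<Rightarrow> real" where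
  "codegree V w \<sigma> = (\<Sum>e | e \<subseteq> V \<and> \<sigma> \<subseteq> e. w e)"

text \<open>Constancy on the whole interval from \<open>T\<close> to \<open>I\<close>, and not just
  \<open>C T = C I\<close>, survives enlarging \<open>T\<close> inside \<open>I\<close>. So
  \<open>T\<close> can absorb the vertices collected at an earlier level. The game uses the case
  \<open>J = T\<close>.\<close>

definition fingerprint :: "('v set \<Rightarrow> 'b) \<Rightarrow> 'v set \<Rightarrow> 'v set \<Rightarrow> bool" where
  "fingerprint C T I \<longleftrightarrow> T \<subseteq> I \<and> (\<forall>J. T \<subseteq> J \<and> J \<subseteq> I \<longrightarrow> C J = C I)"

lemma fingerprintD: "fingerprint C T I \<Longrightarrow> T \<subseteq> J \<Longrightarrow> J \<subseteq> I \<Longrightarrow> C J = C I"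
  unfolding fingerprint_def by blast

lemma fingerprint_mono: "fingerprint C T I \<Longrightarrow> T \<subseteq> T' \<Longrightarrow> T' \<subseteq> I \<Longrightarrow> fingerprint C T' I"
  unfolding fingerprint_def by (meson order_trans)

lemma fingerprint_cong:
  assumes "fingerprint C T I" "\<And>J. T \<subseteq> J \<Longrightarrow> J \<subseteq> I \<Longrightarrow> C' J = C J"
  shows "fingerprint C' T I"
proof -
  have "T \<subseteq> I" using assms(1) by (simp add: fingerprint_def)
  then show ?thesis
    unfolding fingerprint_def
    using assms(2) fingerprintD[OF assms(1)] by (metis order_refl)
qed

text \<open>Only the sets \<open>I\<close> between \<open>S\<^sub>0\<close> and \<open>S\<close> are considered: during the container algorithm,
  \<open>S\<^sub>0\<close> consists of the vertices already known to lie in \<open>I\<close>, and those outside \<open>S\<close> are known not to.\<close>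

definition containers ::
  "'v set \<Rightarrow> 'v set \<Rightarrow> 'v set \<Rightarrow> nat \<Rightarrow> real \<Rightarrow> ('v set \<Rightarrow> bool) \<Rightarrow> bool" where
  "containers V S\<^sub>0 S k b ind \<longleftrightarrow> (\<exists>C. \<forall>I. S\<^sub>0 \<subseteq> I \<and> I \<subseteq> S \<longrightarrow>
     C I \<subseteq> V \<and> real (card (C I)) \<le> b \<and> (ind I \<longrightarrow> I \<subseteq> C I) \<and>
     (\<exists>T. S\<^sub>0 \<subseteq> T \<and> card T \<le> k \<and> fingerprint C T I))"

text \<open>The question whether \<open>v\<close> belongs to the set has the same answer for all
  \<open>J\<close> between \<open>T\<close> and \<open>I\<close>: in the first branch
  \<open>v\<close> lies in \<open>T\<close>, in the second it is not in \<open>I\<close>. So the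
  case distinction does not spoil the fingerprint, and asking the question costs no vertex beyond
  those in \<open>S\<^sub>0\<close>.\<close>

lemma containers_split:
  assumes "containers V (insert v S\<^sub>0) S k b ind" and "containers V S\<^sub>0 (S - {v}) k b ind"
  shows "containers V S\<^sub>0 S k b ind"
proof -
  obtain C1 where C1: "\<And>I. insert v S\<^sub>0 \<subseteq> I \<Longrightarrow> I \<subseteq> S \<Longrightarrow>
     C1 I \<subseteq> V \<and> real (card (C1 I)) \<le> b \<and> (ind I \<longrightarrow> I \<subseteq> C1 I) \<and>
     (\<exists>T. insert v S\<^sub>0 \<subseteq> T \<and> card T \<le> k \<and> fingerprint C1 T I)"
    using assms(1) unfolding containers_def by (metis (no_types, lifting))
  obtain C2 where C2: "\<And>I. S\<^sub>0 \<subseteq> I \<Longrightarrow> I \<subseteq> S - {v} \<Longrightarrow>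
     C2 I \<subseteq> V \<and> real (card (C2 I)) \<le> b \<and> (ind I \<longrightarrow> I \<subseteq> C2 I) \<and>
     (\<exists>T. S\<^sub>0 \<subseteq> T \<and> card T \<le> k \<and> fingerprint C2 T I)"
    using assms(2) unfolding containers_def by (metis (no_types, lifting))
  let ?C = "\<lambda>I. if v \<in> I then C1 I else C2 I"
  show ?thesis
    unfolding containers_def
  proof (intro exI[of _ ?C] allI impI, elim conjE)
    fix I assume I: "S\<^sub>0 \<subseteq> I" "I \<subseteq> S"
    show "?C I \<subseteq> V \<and> real (card (?C I)) \<le> b \<and> (ind I \<longrightarrow> I \<subseteq> ?C I) \<and>
      (\<exists>T. S\<^sub>0 \<subseteq> T \<and> card T \<le> k \<and> fingerprint ?C T I)"
    proof (cases "v \<in> I")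
      case True
      then have *: "insert v S\<^sub>0 \<subseteq> I" using I by auto
      obtain T where T: "insert v S\<^sub>0 \<subseteq> T" "card T \<le> k" "fingerprint C1 T I"
        using C1[OF * I(2)] by blast
      have "fingerprint ?C T I" by (rule fingerprint_cong[OF T(3)]) (use T(1) in auto)
      then have "\<exists>T. S\<^sub>0 \<subseteq> T \<and> card T \<le> k \<and> fingerprint ?C T I"
        using T by (intro exI[of _ T]) simp
      then show ?thesis using C1[OF * I(2)] True by simp
    next
      case False
      then have *: "I \<subseteq> S - {v}" using I by auto
      obtain T where T: "S\<^sub>0 \<subseteq> T" "card T \<le> k" "fingerprint C2 T I"
        using C2[OF I(1) *] by blast
      have "fingerprint ?C T I" by (rule fingerprint_cong[OF T(3)]) (use False in auto)
      then have "\<exists>T. S\<^sub>0 \<subseteq> T \<and> card T \<le> k \<and> fingerprint ?C T I"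
        using T by (intro exI[of _ T]) simp
      then show ?thesis using C2[OF I(1) *] False by simp
    qed
  qed
qed

lemma containers_const:
  assumes "B \<subseteq> V" "real (card B) \<le> b" "card S\<^sub>0 \<le> k"
    and "\<And>I. S\<^sub>0 \<subseteq> I \<Longrightarrow> I \<subseteq> S \<Longrightarrow> ind I \<Longrightarrow> I \<subseteq> B"
  shows "containers V S\<^sub>0 S k b ind"
  unfolding containers_def fingerprint_def using assms by (intro exI[of _ "\<lambda>_. B"]) auto

text \<open>For passing to a hypergraph of lower uniformity: its containers are reused, and the
  vertices already collected join each fingerprint, so that the sizes add up.\<close>

lemma containers_extend:
  assumes "containers V {} V k b ind'" "S \<subseteq> V" "card S\<^sub>0 \<le> m" "b \<le> b'"
    and "\<And>I. S\<^sub>0 \<subseteq> I \<Longrightarrow> I \<subseteq> S \<Longrightarrow> ind I \<Longrightarrow> ind' I"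
  shows "containers V S\<^sub>0 S (m + k) b' ind"
proof -
  obtain C where C: "\<And>I. I \<subseteq> V \<Longrightarrow>
     C I \<subseteq> V \<and> real (card (C I)) \<le> b \<and> (ind' I \<longrightarrow> I \<subseteq> C I) \<and>
     (\<exists>T. card T \<le> k \<and> fingerprint C T I)"
    using assms(1) unfolding containers_def by auto
  show ?thesis
    unfolding containers_def
  proof (intro exI[of _ C] allI impI, elim conjE)
    fix I assume I: "S\<^sub>0 \<subseteq> I" "I \<subseteq> S"
    with assms(2) have IV: "I \<subseteq> V" by auto
    obtain T where T: "card T \<le> k" "fingerprint C T I" using C[OF IV] by blast
    have "card (S\<^sub>0 \<union> T) \<le> m + k"
      using card_Un_le[of S\<^sub>0 T] T(1) assms(3) by linarith
    moreover have "fingerprint C (S\<^sub>0 \<union> T) I"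
      using T(2) I(1) by (intro fingerprint_mono[OF T(2)]) (auto simp: fingerprint_def)
    ultimately have "\<exists>T. S\<^sub>0 \<subseteq> T \<and> card T \<le> m + k \<and> fingerprint C T I"
      by (intro exI[of _ "S\<^sub>0 \<union> T"]) simp
    then show "C I \<subseteq> V \<and> real (card (C I)) \<le> b' \<and> (ind I \<longrightarrow> I \<subseteq> C I) \<and>
      (\<exists>T. S\<^sub>0 \<subseteq> T \<and> card T \<le> m + k \<and> fingerprint C T I)"
      using C[OF IV] assms(4) assms(5)[OF I] by auto
  qed
qed

section \<open>Weights, codegrees and links\<close>

lemma sum_Un_le:
  fixes w :: "'a \<Rightarrow> real"
  assumes "finite A" "finite B" "\<And>x. x \<in> A \<inter> B \<Longrightarrow> 0 \<le> w x"
  shows "sum w (A \<union> B) \<le> sum w A + sum w B"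
  using sum.union_inter[OF assms(1,2), of w] sum_nonneg[of "A \<inter> B" w, OF assms(3)] by simp

lemma sum_Bex_le:
  fixes w :: "'a \<Rightarrow> real"
  assumes "finite S" "finite B" "\<And>x. x \<in> S \<Longrightarrow> 0 \<le> w x"
  shows "sum w {x \<in> S. \<exists>y\<in>B. P y x} \<le> (\<Sum>y\<in>B. sum w {x \<in> S. P y x})"
proof -
  have "{x \<in> S. \<exists>y\<in>B. P y x} = (\<Union>y\<in>B. {x \<in> S. P y x})" by auto
  then have "sum w {x \<in> S. \<exists>y\<in>B. P y x} = sum w (\<Union>y\<in>B. {x \<in> S. P y x})" by simp
  also have "\<dots> \<le> (\<Sum>y\<in>B. sum w {x \<in> S. P y x})"
    using assms(2)
  proof (induction B rule: finite_induct)
    case (insert y B)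
    have "sum w (\<Union>y\<in>insert y B. {x \<in> S. P y x})
        \<le> sum w {x \<in> S. P y x} + sum w (\<Union>y\<in>B. {x \<in> S. P y x})"
      using assms(1,3) insert(1) by (simp, intro sum_Un_le) auto
    with insert show ?case by simp
  qed simp
  finally show ?thesis .
qed

text \<open>After swapping the sums, each edge is counted once for each of its \<open>2 ^ r\<close>
  subsets.\<close>

lemma sum_codegree:
  assumes "finite V" "\<And>e. w e \<noteq> 0 \<Longrightarrow> card e = r"
  shows "(\<Sum>\<sigma>\<in>Pow V. codegree V w \<sigma>) = 2 ^ r * codegree V w {}"
proof -
  have "(\<Sum>\<sigma>\<in>Pow V. codegree V w \<sigma>) = (\<Sum>\<sigma>\<in>Pow V. \<Sum>e\<in>Pow V. if \<sigma> \<subseteq> e then w e else 0)"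
  proof (rule sum.cong[OF refl])
    fix \<sigma>
    have "{e. e \<subseteq> V \<and> \<sigma> \<subseteq> e} = {e \<in> Pow V. \<sigma> \<subseteq> e}" by auto
    then show "codegree V w \<sigma> = (\<Sum>e\<in>Pow V. if \<sigma> \<subseteq> e then w e else 0)"
      using assms(1) by (simp only: codegree_def sum.inter_filter finite_Pow_iff)
  qed
  also have "\<dots> = (\<Sum>e\<in>Pow V. \<Sum>\<sigma>\<in>Pow V. if \<sigma> \<subseteq> e then w e else 0)" by (rule sum.swap)
  also have "\<dots> = (\<Sum>e\<in>Pow V. 2 ^ r * w e)"
  proof (rule sum.cong[OF refl])
    fix e assume e: "e \<in> Pow V"
    have "(\<Sum>\<sigma>\<in>Pow V. if \<sigma> \<subseteq> e then w e else 0) = (\<Sum>\<sigma>\<in>{\<sigma>\<in>Pow V. \<sigma> \<subseteq> e}. w e)"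
      using assms(1) by (simp flip: sum.inter_filter)
    also have "{\<sigma>\<in>Pow V. \<sigma> \<subseteq> e} = Pow e" using e by auto
    also have "(\<Sum>\<sigma>\<in>Pow e. w e) = 2 ^ card e * w e"
      using e assms(1) by (simp add: card_Pow finite_subset)
    also have "\<dots> = 2 ^ r * w e" using assms(2) by (cases "w e = 0") auto
    finally show "(\<Sum>\<sigma>\<in>Pow V. if \<sigma> \<subseteq> e then w e else 0) = 2 ^ r * w e" .
  qed
  also have "\<dots> = 2 ^ r * codegree V w {}"
    by (simp add: codegree_def sum_distrib_left Pow_def)
  finally show ?thesis .
qed

text \<open>The part of the link of \<open>v\<close> that is added to the hypergraph of lower uniformity under
  construction; \<open>sat\<close> marks the sets whose codegree there is already as large as can be tolerated.\<close>

definition link :: "'v set \<Rightarrow> ('v set \<Rightarrow> bool) \<Rightarrow> ('v set \<Rightarrow> real) \<Rightarrow> 'v \<Rightarrow> 'v set \<Rightarrow> real" where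
  "link A sat w v e = (if v \<notin> e \<and> insert v e \<subseteq> A \<and> (\<forall>\<sigma>\<subseteq>e. \<sigma> \<noteq> {} \<longrightarrow> \<not> sat \<sigma>)
     then w (insert v e) else 0)"

lemma codegree_link_le:
  assumes "finite V" "v \<in> V" "\<And>e. 0 \<le> w e"
  shows "codegree V (link A sat w v) \<sigma> \<le> codegree V w (insert v \<sigma>)"
proof -
  let ?S = "{e. e \<subseteq> V \<and> \<sigma> \<subseteq> e \<and> v \<notin> e}"
  have "codegree V (link A sat w v) \<sigma> = sum (link A sat w v) ?S"
    unfolding codegree_def using assms(1)
    by (intro sum.mono_neutral_right) (auto simp: link_def)
  also have "\<dots> \<le> (\<Sum>e\<in>?S. w (insert v e))"
    using assms(3) by (intro sum_mono) (auto simp: link_def)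
  also have "\<dots> = sum w (insert v ` ?S)"
    by (subst sum.reindex) (auto simp: inj_on_def)
  also have "\<dots> \<le> codegree V w (insert v \<sigma>)"
    unfolding codegree_def using assms by (intro sum_mono2) auto
  finally show ?thesis .
qed

lemma codegree_add: "codegree V (\<lambda>e. w e + w' e) \<sigma> = codegree V w \<sigma> + codegree V w' \<sigma>"
  by (simp add: codegree_def sum.distrib)

lemma codegree_nonneg: "(\<And>e. 0 \<le> w e) \<Longrightarrow> 0 \<le> codegree V w \<sigma>"
  by (simp add: codegree_def sum_nonneg)

text \<open>Double counting over \<open>\<sigma>\<close> shows that at most a quarter of the weight of \<open>w\<close> lies on edges
  containing a saturated set, and the sparse links account for another quarter. The rest must meet
  the complement of \<open>A\<close>.\<close>

lemma sparse_links_imp_small: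
  fixes w w' :: "'v set \<Rightarrow> real" and D K L q :: real
  assumes V: "finite V" "A \<subseteq> V" "V \<noteq> {}" and w: "\<And>e. 0 \<le> w e" "\<And>e. w e \<noteq> 0 \<Longrightarrow> card e = Suc r"
    and w': "\<And>e. 0 \<le> w' e" "\<And>e. w' e \<noteq> 0 \<Longrightarrow> card e = r"
    and pos: "D > 0" "K > 0" "L > 0" "q > 0"
    and total: "codegree V w {} = D * card V"
    and deg: "\<And>\<sigma>. \<sigma> \<subseteq> V \<Longrightarrow> \<sigma> \<noteq> {} \<Longrightarrow> codegree V w \<sigma> \<le> K * q ^ (card \<sigma> - 1) * D"
    and total': "codegree V w' {} \<le> q * card V * K * D"
    and L: "L = 2 ^ (r + 2) * K"
    and sat: "\<And>\<sigma>. sat \<sigma> \<Longrightarrow> codegree V w' \<sigma> \<ge> L * K * q ^ card \<sigma> * D"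
    and sparse: "\<And>v. v \<in> A \<Longrightarrow> codegree V (link A sat w v) {} < D / 4"
  shows "real (card A) \<le> card V - card V / (2 * K)"
proof -
  let ?N = "real (card V)"
  have fP: "finite {e. e \<subseteq> V}" using V(1) by simp
  define Sat where "Sat = {\<sigma>. \<sigma> \<subseteq> V \<and> \<sigma> \<noteq> {} \<and> sat \<sigma>}"
  have fS: "finite Sat" using V(1) unfolding Sat_def by simp
  have fA: "finite A" using V finite_subset by auto
  \<comment> \<open>An edge inside \<open>A\<close> without saturated subsets, with any one of its
    vertices \<open>v\<close> removed, is an edge of the link of \<open>v\<close>. Edges of nonzero
    weight are nonempty, so the sparse links account for all of them.\<close>
  have E1: "sum w {e. e \<subseteq> A \<and> (\<forall>\<sigma>\<in>Sat. \<not> \<sigma> \<subseteq> e)} \<le> ?N * D / 4"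
  proof -
    let ?E = "{e. e \<subseteq> A \<and> (\<forall>\<sigma>\<in>Sat. \<not> \<sigma> \<subseteq> e)}"
    have "sum w ?E = sum w {e \<in> ?E. e \<noteq> {}}"
    proof (rule sum.mono_neutral_right)
      show "\<forall>i\<in>?E - {e \<in> ?E. e \<noteq> {}}. w i = 0" using w(2)[of "{}"] by auto
    qed (use fA in auto)
    also have "\<dots> \<le> sum w {e \<in> ?E. \<exists>v\<in>A. v \<in> e}"
      using fA w(1) by (intro sum_mono2) auto
    also have "\<dots> \<le> (\<Sum>v\<in>A. sum w {e \<in> ?E. v \<in> e})"
      using fA w(1) by (intro sum_Bex_le) auto
    also have "\<dots> \<le> (\<Sum>v\<in>A. D / 4)"
    proof (rule sum_mono)
      fix v assume v: "v \<in> A"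
      have "sum w {e \<in> ?E. v \<in> e} \<le> (\<Sum>e\<in>{e \<in> ?E. v \<in> e}. link A sat w v (e - {v}))"
      proof (rule sum_mono)
        fix e assume e: "e \<in> {e \<in> ?E. v \<in> e}"
        have "\<not> sat \<sigma>" if "\<sigma> \<subseteq> e - {v}" "\<sigma> \<noteq> {}" for \<sigma>
          using e that V(2) unfolding Sat_def by blast
        moreover have "insert v (e - {v}) = e" using e by auto
        ultimately show "w e \<le> link A sat w v (e - {v})" using e by (auto simp: link_def)
      qed
      also have "\<dots> = sum (link A sat w v) ((\<lambda>e. e - {v}) ` {e \<in> ?E. v \<in> e})"
        by (subst sum.reindex) (auto simp: inj_on_def)
      also have "\<dots> \<le> codegree V (link A sat w v) {}"
        unfolding codegree_def using V w(1) by (intro sum_mono2) (auto simp: link_def)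
      finally show "sum w {e \<in> ?E. v \<in> e} \<le> D / 4" using sparse[OF v] by simp
    qed
    also have "\<dots> \<le> ?N * D / 4"
      using card_mono[OF V(1,2)] pos by (simp add: field_simps)
    finally show ?thesis .
  qed
  have E2: "sum w {e \<in> {e. e \<subseteq> V}. \<exists>\<sigma>\<in>Sat. \<sigma> \<subseteq> e} \<le> ?N * D / 4"
  proof -
    have "sum w {e \<in> {e. e \<subseteq> V}. \<exists>\<sigma>\<in>Sat. \<sigma> \<subseteq> e} \<le> (\<Sum>\<sigma>\<in>Sat. sum w {e \<in> {e. e \<subseteq> V}. \<sigma> \<subseteq> e})"
      using fS fP w(1) by (intro sum_Bex_le) auto
    also have "\<dots> = (\<Sum>\<sigma>\<in>Sat. codegree V w \<sigma>)" by (simp add: codegree_def)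
    \<comment> \<open>On a saturated set the upper bound for the codegree in \<open>w\<close> is at
      most \<open>1 / (L * q)\<close> times the codegree in \<open>w'\<close>. The latter can be
      summed over all sets by double counting.\<close>
    also have "\<dots> \<le> (\<Sum>\<sigma>\<in>Sat. codegree V w' \<sigma> / (L * q))"
    proof (rule sum_mono)
      fix \<sigma> assume s: "\<sigma> \<in> Sat"
      then have ss: "\<sigma> \<subseteq> V" "\<sigma> \<noteq> {}" "sat \<sigma>" by (auto simp: Sat_def)
      then have "card \<sigma> = Suc (card \<sigma> - 1)"
        using V(1) by (metis Suc_diff_1 card_gt_0_iff finite_subset)
      then have "L * q * (K * q ^ (card \<sigma> - 1) * D) = L * K * q ^ card \<sigma> * D"
        by (metis (no_types, opaque_lifting) mult.assoc mult.commute power_Suc)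
      moreover have "L * q * codegree V w \<sigma> \<le> L * q * (K * q ^ (card \<sigma> - 1) * D)"
        using pos by (intro mult_left_mono deg[OF ss(1,2)]) auto
      ultimately have "L * q * codegree V w \<sigma> \<le> L * K * q ^ card \<sigma> * D" by metis
      also have "\<dots> \<le> codegree V w' \<sigma>" by (rule sat[OF ss(3)])
      finally show "codegree V w \<sigma> \<le> codegree V w' \<sigma> / (L * q)"
        using pos by (simp add: field_simps)
    qed
    also have "\<dots> \<le> (\<Sum>\<sigma>\<in>Pow V. codegree V w' \<sigma> / (L * q))"
      using V(1) pos by (intro sum_mono2 divide_nonneg_pos codegree_nonneg w'(1)) (auto simp: Sat_def)
    also have "\<dots> = 2 ^ r * codegree V w' {} / (L * q)"
      by (simp add: sum_codegree[OF V(1) w'(2)] flip: sum_divide_distrib)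
    also have "\<dots> \<le> 2 ^ r * (q * ?N * K * D) / (L * q)"
      using total' pos by (intro divide_right_mono mult_left_mono) auto
    \<comment> \<open>This determines \<open>L\<close>: its factor \<open>2 ^ r\<close> cancels the
      double counting, and the remaining 4 gives the quarter.\<close>
    also have "\<dots> = ?N * D / 4"
      using pos by (simp add: L field_simps)
    finally show ?thesis .
  qed
  have E3: "sum w {e \<in> {e. e \<subseteq> V}. \<exists>v\<in>V - A. v \<in> e} \<le> real (card (V - A)) * K * D"
  proof -
    have "sum w {e \<in> {e. e \<subseteq> V}. \<exists>v\<in>V - A. v \<in> e} \<le> (\<Sum>v\<in>V-A. sum w {e \<in> {e. e \<subseteq> V}. v \<in> e})"
      using V fP w(1) by (intro sum_Bex_le) auto
    also have "\<dots> = (\<Sum>v\<in>V-A. codegree V w {v})" by (simp add: codegree_def)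
    also have "\<dots> \<le> (\<Sum>v\<in>V-A. K * D)"
      using deg[of "{_}"] by (intro sum_mono) auto
    finally show ?thesis by (simp add: mult.assoc)
  qed
  let ?X = "{e. e \<subseteq> A \<and> (\<forall>\<sigma>\<in>Sat. \<not> \<sigma> \<subseteq> e)}"
  let ?Y = "{e \<in> {e. e \<subseteq> V}. \<exists>\<sigma>\<in>Sat. \<sigma> \<subseteq> e}"
  let ?Z = "{e \<in> {e. e \<subseteq> V}. \<exists>v\<in>V - A. v \<in> e}"
  have "D * ?N = sum w {e. e \<subseteq> V}" using total by (simp add: codegree_def)
  also have "\<dots> \<le> sum w (?X \<union> (?Y \<union> ?Z))"
    using V fP w(1) fA by (intro sum_mono2) auto
  also have "\<dots> \<le> sum w ?X + sum w (?Y \<union> ?Z)"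
    using V fP w(1) fA by (intro sum_Un_le) auto
  also have "sum w (?Y \<union> ?Z) \<le> sum w ?Y + sum w ?Z"
    using V fP w(1) by (intro sum_Un_le) auto
  finally have "D * ?N \<le> ?N * D / 4 + ?N * D / 4 + real (card (V - A)) * K * D"
    using E1 E2 E3 by linarith
  \<comment> \<open>Half of the total weight is left for edges that leave \<open>A\<close>, while
    each vertex outside \<open>A\<close> carries at most \<open>K * D\<close>.\<close>
  then have "D * (?N / 2) \<le> D * (real (card (V - A)) * K)"
    by (simp add: field_simps)
  then have "?N / 2 \<le> real (card (V - A)) * K" using pos(1) by simp
  then have "?N / (2 * K) \<le> real (card (V - A))" using pos by (simp add: field_simps)
  moreover have "real (card (V - A)) = ?N - card A"
    using V fA card_mono[OF V(1,2)] by (simp add: card_Diff_subset of_nat_diff)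
  ultimately show ?thesis by linarith
qed

text \<open>The codegree condition of the container method. The average degree is
  \<open>r * D\<close>, and every vertex fixed beyond the first costs a factor \<open>q\<close>,
  which will be the density \<open>m / card V\<close> of the part of the fingerprint collected at
  one level.\<close>

definition spread :: "'v set \<Rightarrow> ('v set \<Rightarrow> real) \<Rightarrow> nat \<Rightarrow> real \<Rightarrow> real \<Rightarrow> real \<Rightarrow> bool" where
  "spread V w r K D q \<longleftrightarrow> (\<forall>e. 0 \<le> w e) \<and> (\<forall>e. w e \<noteq> 0 \<longrightarrow> card e = r) \<and>
     codegree V w {} = D * card V \<and>
     (\<forall>\<sigma>\<subseteq>V. \<sigma> \<noteq> {} \<longrightarrow> codegree V w \<sigma> \<le> K * q ^ (card \<sigma> - 1) * D)"

definition edge_free :: "('v set \<Rightarrow> real) \<Rightarrow> 'v set \<Rightarrow> bool" where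
  "edge_free w I \<longleftrightarrow> (\<forall>e. w e \<noteq> 0 \<longrightarrow> \<not> e \<subseteq> I)"

text \<open>One level of the container algorithm. While some \<open>v \<in> A\<close> has a heavy admissible link, ask whether
  \<open>v \<in> I\<close>: if not, drop \<open>v\<close>; if so, add \<open>v\<close> to the fingerprint \<open>S\<^sub>0\<close> and its link to \<open>w'\<close>. Either \<open>m\<close>
  vertices are collected, and then \<open>w'\<close> is spread and \<open>I\<close> is edge-free for it, so that the next level
  applies; or the links become sparse, and then \<open>A \<union> S\<^sub>0\<close> is a small container.\<close>

lemma containers_state:
  fixes w w' :: "'v set \<Rightarrow> real" and D K L q b b' :: real
  assumes V: "finite V" "V \<noteq> {}" and w: "spread V w (Suc r) K D q"
    and pos: "D > 0" "K > 0" "m > 0" and q: "q = real m / card V"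
    and L: "L = 2 ^ (r + 2) * K" and m: "real m \<le> card V / (4 * K)"
    and next_level: "\<And>w' (D' :: real). D' > 0 \<Longrightarrow> spread V w' r (4 * (L + 1) * K) D' q \<Longrightarrow>
      containers V {} V k b (edge_free w')"
    and b: "b \<le> b'" "card V - card V / (4 * K) \<le> b'"
    and "A \<subseteq> V" "S\<^sub>0 \<subseteq> V" "A \<inter> S\<^sub>0 = {}" "card S\<^sub>0 \<le> m"
    and "\<And>e. 0 \<le> w' e"
    and "\<And>e. w' e \<noteq> 0 \<Longrightarrow> card e = r \<and> (\<exists>v\<in>S\<^sub>0. w (insert v e) \<noteq> 0)"
    and "card S\<^sub>0 * (D / 4) \<le> codegree V w' {}"
    and "codegree V w' {} \<le> card S\<^sub>0 * (K * D)"
    and "\<And>\<sigma>. \<sigma> \<subseteq> V \<Longrightarrow> \<sigma> \<noteq> {} \<Longrightarrow> codegree V w' \<sigma> \<le> (L + 1) * K * q ^ card \<sigma> * D"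
  shows "containers V S\<^sub>0 (A \<union> S\<^sub>0) (m + k) b' (edge_free w)"
  using assms(13-)
proof (induction "card A" arbitrary: A S\<^sub>0 w' rule: less_induct)
  case less
  note A = less.prems(1-3) and S\<^sub>0 = less.prems(4) and w'0 = less.prems(5)
    and w'_supp = less.prems(6) and lower = less.prems(7) and upper = less.prems(8)
    and w'_deg = less.prems(9)
  let ?N = "real (card V)"
  have N: "?N > 0" using V by (simp add: card_gt_0_iff)
  have q0: "q > 0" using N pos q by simp
  have qN: "q * ?N = m" using N q by simp
  have L0: "L > 0" using pos L by simp
  have w0: "\<And>e. 0 \<le> w e" and w_unif: "\<And>e. w e \<noteq> 0 \<Longrightarrow> card e = Suc r"
    and w_total: "codegree V w {} = D * card V"
    and w_deg: "\<And>\<sigma>. \<sigma> \<subseteq> V \<Longrightarrow> \<sigma> \<noteq> {} \<Longrightarrow> codegree V w \<sigma> \<le> K * q ^ (card \<sigma> - 1) * D"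
    using w by (auto simp: spread_def)
  have fin: "finite A" "finite S\<^sub>0" using A V by (auto intro: finite_subset)
  \<comment> \<open>A saturated set receives no further weight, and one link adds at most
    \<open>K * q ^ card \<sigma> * D\<close> to any other nonempty set. Hence the bound with
    \<open>L + 1\<close> persists although the threshold is \<open>L\<close>.\<close>
  define sat where "sat \<sigma> \<longleftrightarrow> codegree V w' \<sigma> \<ge> L * K * q ^ card \<sigma> * D" for \<sigma>
  consider (full) "card S\<^sub>0 = m" | (sparse) "\<And>v. v \<in> A \<Longrightarrow> codegree V (link A sat w v) {} < D / 4"
    | (step) v where "card S\<^sub>0 < m" "v \<in> A" "codegree V (link A sat w v) {} \<ge> D / 4"
    using S\<^sub>0 by fastforce
  then show ?case
  proof cases
    case full
    \<comment> \<open>The \<open>m = q * ?N\<close> links collected have weight at least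
      \<open>D / 4\<close> each, so \<open>D'\<close> is at least \<open>q * D / 4\<close>.
      Rewriting \<open>q ^ card \<sigma> * D\<close> in terms of \<open>D'\<close> uses up one power
      of \<open>q\<close> and produces the 4 in the new constant
      \<open>4 * (L + 1) * K\<close>.\<close>
    define D' where "D' = codegree V w' {} / ?N"
    have D': "D' \<ge> q * D / 4" using lower full N by (simp add: D'_def q field_simps)
    then have "D' > 0" using q0 pos by (smt (verit) divide_pos_pos mult_pos_pos)
    moreover have "spread V w' r (4 * (L + 1) * K) D' q"
      unfolding spread_def
    proof (intro conjI allI impI)
      fix \<sigma> assume s: "\<sigma> \<subseteq> V" "\<sigma> \<noteq> {}"
      then have c: "card \<sigma> = Suc (card \<sigma> - 1)"
        using V(1) by (metis Suc_diff_1 card_gt_0_iff finite_subset)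
      have "codegree V w' \<sigma> \<le> (L + 1) * K * q ^ card \<sigma> * D" by (rule w'_deg[OF s])
      also have "\<dots> = (4 * (L + 1) * K * q ^ (card \<sigma> - 1)) * (q * D / 4)"
        by (subst c) simp
      also have "\<dots> \<le> (4 * (L + 1) * K * q ^ (card \<sigma> - 1)) * D'"
        using D' L0 pos q0 by (intro mult_left_mono) auto
      finally show "codegree V w' \<sigma> \<le> 4 * (L + 1) * K * q ^ (card \<sigma> - 1) * D'" .
    qed (use w'0 w'_supp N in \<open>auto simp: D'_def\<close>)
    ultimately have "containers V {} V k b (edge_free w')" by (rule next_level)
    then show ?thesis
    proof (rule containers_extend)
      \<comment> \<open>An edge of \<open>w'\<close> inside \<open>I\<close> would extend, by some
        vertex of \<open>S\<^sub>0\<close>, to an edge of \<open>w\<close> inside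
        \<open>I\<close>.\<close>
      fix I assume "S\<^sub>0 \<subseteq> I" "edge_free w I"
      then show "edge_free w' I"
        using w'_supp unfolding edge_free_def by (metis insert_subset subset_iff)
    qed (use A S\<^sub>0 b in auto)
  next
    case sparse
    have "real (card A) \<le> ?N - ?N / (2 * K)"
    proof (rule sparse_links_imp_small[where r = r and w = w and w' = w' and sat = sat and q = q and D = D and L = L])
      show "codegree V w' {} \<le> q * ?N * K * D"
        using upper S\<^sub>0 qN pos by (smt (verit) mult.assoc mult_pos_pos mult_right_mono of_nat_mono)
    qed (use V A w0 w_unif w'0 w'_supp pos L0 q0 w_total w_deg L sparse in \<open>auto simp: sat_def\<close>)
    moreover have "real (card (A \<union> S\<^sub>0)) \<le> real (card A) + m"
      using card_Un_le[of A S\<^sub>0] S\<^sub>0 by linarith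
    \<comment> \<open>Half of the missing \<open>?N / (2 * K)\<close> vertices pay for putting
      \<open>S\<^sub>0\<close> back into the container; this is why \<open>m\<close> is bounded by
      \<open>card V / (4 * K)\<close>.\<close>
    moreover have "?N / (2 * K) = ?N / (4 * K) + ?N / (4 * K)" by (simp add: field_simps)
    ultimately have "real (card (A \<union> S\<^sub>0)) \<le> b'" using b m by linarith
    then show ?thesis using A S\<^sub>0 by (intro containers_const[where B = "A \<union> S\<^sub>0"]) auto
  next
    case (step v)
    have v: "v \<in> V" "v \<notin> S\<^sub>0" using step A by auto
    let ?l = "link A sat w v"
    have small: "card (A - {v}) < card A" using step(2) fin(1) by (rule card_Diff1_less[rotated])
    have l0: "0 \<le> ?l e" for e using w0 by (simp add: link_def)
    have l_deg: "codegree V ?l \<sigma> \<le> codegree V w (insert v \<sigma>)" for \<sigma>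
      by (rule codegree_link_le[OF V(1) v(1) w0])
    have "containers V (insert v S\<^sub>0) ((A - {v}) \<union> insert v S\<^sub>0) (m + k) b' (edge_free w)"
    proof (rule less.hyps[OF small, where w' = "\<lambda>e. w' e + ?l e"])
      fix e assume "w' e + ?l e \<noteq> 0"
      then consider "w' e \<noteq> 0" | "?l e \<noteq> 0" by (cases "w' e = 0") simp_all
      then show "card e = r \<and> (\<exists>v\<in>insert v S\<^sub>0. w (insert v e) \<noteq> 0)"
      proof cases
        case 1
        then show ?thesis using w'_supp by auto
      next
        case 2
        then have *: "v \<notin> e" "w (insert v e) \<noteq> 0" by (auto simp: link_def split: if_splits)
        then have "card (insert v e) = Suc r" by (intro w_unif)
        moreover from this have "finite e"
          by (metis card.infinite finite_insert nat.distinct(1))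
        ultimately show ?thesis using * by simp
      qed
    next
      show "real (card (insert v S\<^sub>0)) * (D / 4) \<le> codegree V (\<lambda>e. w' e + ?l e) {}"
        using lower step(3) v fin by (simp add: codegree_add algebra_simps)
      have "codegree V ?l {} \<le> K * D"
        using l_deg[of "{}"] w_deg[of "{v}"] v by simp
      then show "codegree V (\<lambda>e. w' e + ?l e) {} \<le> real (card (insert v S\<^sub>0)) * (K * D)"
        using upper v fin by (simp add: codegree_add algebra_simps)
    next
      fix \<sigma> assume s: "\<sigma> \<subseteq> V" "\<sigma> \<noteq> {}"
      have fs: "finite \<sigma>" using s V finite_subset by auto
      show "codegree V (\<lambda>e. w' e + ?l e) \<sigma> \<le> (L + 1) * K * q ^ card \<sigma> * D"
      proof (cases "sat \<sigma> \<or> v \<in> \<sigma>")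
        case True
        \<comment> \<open>By definition the link has no edge that contains \<open>v\<close> or a
          nonempty saturated set.\<close>
        then have "codegree V ?l \<sigma> = 0"
          unfolding codegree_def using s by (intro sum.neutral) (auto simp: link_def)
        then show ?thesis using w'_deg[OF s] by (simp add: codegree_add)
      next
        case False
        then have "codegree V w' \<sigma> \<le> L * K * q ^ card \<sigma> * D" by (simp add: sat_def)
        moreover have "codegree V ?l \<sigma> \<le> K * q ^ card \<sigma> * D"
          using l_deg[of \<sigma>] w_deg[of "insert v \<sigma>"] s v False fs by simp
        ultimately show ?thesis by (simp add: codegree_add algebra_simps)
      qed
    qed (use A v step fin l0 w'0 in \<open>auto intro: add_nonneg_nonneg\<close>)
    moreover have "(A - {v}) \<union> insert v S\<^sub>0 = A \<union> S\<^sub>0" using step(2) by auto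
    moreover have "containers V S\<^sub>0 ((A - {v}) \<union> S\<^sub>0) (m + k) b' (edge_free w)"
    proof (rule less.hyps[OF small, where w' = w'])
    qed (use A S\<^sub>0 w'0 w'_supp lower upper w'_deg in auto)
    moreover have "(A - {v}) \<union> S\<^sub>0 = (A \<union> S\<^sub>0) - {v}" using v by auto
    ultimately show ?thesis using containers_split by metis
  qed
qed

text \<open>Induction on the uniformity, starting \<open>containers_state\<close> from
  \<open>A = V\<close> with nothing collected. Each level adds at most \<open>m\<close> vertices to
  the fingerprint and replaces \<open>K\<close> by a larger constant depending on \<open>K\<close>
  and \<open>r\<close> alone, so \<open>\<delta>\<close> can be fixed before the hypergraph.\<close>

lemma hypergraph_containers:
  fixes K :: real
  assumes "K > 0"
  shows "\<exists>\<delta>>0::real. \<forall>(V :: 'v set) m w (D :: real). finite V \<and> V \<noteq> {} \<and> 0 < m \<and> real m \<le> \<delta> * card V \<and> D > 0 \<and>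
    spread V w (Suc r) K D (real m / card V) \<longrightarrow>
    containers V {} V (Suc r * m) ((1 - \<delta>) * card V) (edge_free w)"
  using assms
proof (induction r arbitrary: K)
  case 0
  show ?case
  proof (intro exI[of _ "1 / K"] conjI allI impI, goal_cases)
    case (2 V m w D)
    then have V: "finite V" "V \<noteq> {}" and D: "D > 0" by auto
    have sp: "spread V w 1 K D (real m / card V)" using 2 by simp
    have w0: "\<And>e. 0 \<le> w e" and w_unif: "\<And>e. w e \<noteq> 0 \<Longrightarrow> card e = 1"
      and w_total: "codegree V w {} = D * card V"
      using sp by (simp_all add: spread_def)
    have w_deg: "codegree V w {v} \<le> K * D" if "v \<in> V" for v
      using sp[unfolded spread_def, THEN conjunct2, THEN conjunct2, THEN conjunct2, rule_format, of "{v}"]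
        that by simp
    \<comment> \<open>In a 1-uniform hypergraph the edge-free subsets of \<open>V\<close> are those
      avoiding \<open>?X\<close>, so a single container with empty fingerprint serves them all. The
      degree bound forces \<open>?X\<close> to contain a proportion \<open>1 / K\<close> of the
      vertices.\<close>
    let ?X = "{v\<in>V. w {v} \<noteq> 0}"
    have "D * card V = sum w {e. e \<subseteq> V}" using w_total by (simp add: codegree_def)
    also have "\<dots> = sum w ((\<lambda>v. {v}) ` ?X)"
    proof (rule sum.mono_neutral_right)
      show "\<forall>e\<in>{e. e \<subseteq> V} - (\<lambda>v. {v}) ` ?X. w e = 0"
        using w_unif by (force simp: card_1_singleton_iff image_iff)
    qed (use V in auto)
    also have "\<dots> = (\<Sum>v\<in>?X. w {v})" by (subst sum.reindex) auto
    also have "\<dots> \<le> (\<Sum>v\<in>?X. K * D)"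
    proof (rule sum_mono)
      fix v assume v: "v \<in> ?X"
      have "w {v} \<le> codegree V w {v}"
        unfolding codegree_def using V v w0 by (intro member_le_sum) auto
      then show "w {v} \<le> K * D" using w_deg[of v] v by simp
    qed
    finally have "D * card V \<le> D * (card ?X * K)" by (simp add: mult_ac)
    then have "card V / K \<le> card ?X" using D 0 by (simp add: field_simps)
    moreover have "card ?X \<le> card V" using V by (intro card_mono) auto
    moreover have "card (V - ?X) = card V - card ?X" using V by (intro card_Diff_subset) auto
    ultimately have "real (card (V - ?X)) \<le> (1 - 1 / K) * card V"
      by (simp add: of_nat_diff algebra_simps)
    then show ?case
      by (intro containers_const[where B = "V - ?X"]) (auto simp: edge_free_def)
  qed (use 0 in auto)
next
  case (Suc r)
  define L where "L = 2 ^ (Suc r + 2) * K"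
  have "4 * (L + 1) * K > 0" using Suc.prems by (simp add: L_def add_pos_pos)
  from Suc.IH[OF this] obtain \<delta> :: real where \<delta>: "\<delta> > 0" and IH: "\<forall>(V :: 'v set) m w D.
      finite V \<and> V \<noteq> {} \<and> 0 < m \<and> real m \<le> \<delta> * card V \<and> D > 0 \<and>
      spread V w (Suc r) (4 * (L + 1) * K) D (real m / card V) \<longrightarrow>
      containers V {} V (Suc r * m) ((1 - \<delta>) * card V) (edge_free w)"
    by (elim exE conjE)
  \<comment> \<open>The bound by \<open>\<delta>\<close> serves the next level. The bound by
    \<open>1 / (4 * K)\<close> serves this one twice: for the size of \<open>m\<close> and for the
    container found when the links become sparse.\<close>
  define \<epsilon> where "\<epsilon> = min \<delta> (1 / (4 * K))"
  have \<epsilon>: "\<epsilon> > 0" "\<epsilon> \<le> \<delta>" "\<epsilon> \<le> 1 / (4 * K)" using \<delta> Suc.prems by (auto simp: \<epsilon>_def)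
  show ?case
  proof (intro exI[of _ \<epsilon>] conjI allI impI, goal_cases)
    case (2 V m w D)
    then have V: "finite V" "V \<noteq> {}" and D: "D > 0" and m: "0 < m" "real m \<le> \<epsilon> * card V"
      and w: "spread V w (Suc (Suc r)) K D (real m / card V)" by auto
    have mono: "\<epsilon> * card V \<le> \<delta> * card V" "\<epsilon> * card V \<le> card V / (4 * K)"
      using mult_right_mono[OF \<epsilon>(2), of "card V"] mult_right_mono[OF \<epsilon>(3), of "card V"] by auto
    have "containers V {} (V \<union> {}) (m + Suc r * m) ((1 - \<epsilon>) * card V) (edge_free w)"
    proof (rule containers_state[where w' = "\<lambda>_. 0", OF V w D Suc.prems m(1) refl L_def])
      show "containers V {} V (Suc r * m) ((1 - \<delta>) * card V) (edge_free w')"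
        if "D' > 0" "spread V w' (Suc r) (4 * (L + 1) * K) D' (real m / card V)" for w' D'
        using V m that mono by (intro IH[rule_format] conjI) auto
      show "real m \<le> card V / (4 * K)" using m mono by linarith
    qed (use mono Suc.prems D in \<open>auto simp: codegree_def algebra_simps L_def intro!: mult_nonneg_nonneg\<close>)
    then show ?case by simp
  qed (use \<epsilon> in auto)
qed

section \<open>Erdos--Selfridge with Maker as the hitter\<close>

definition breaker_claims :: "'e list \<Rightarrow> 'e set" where
  "breaker_claims xs = {xs ! i | i. i < length xs \<and> odd i}"

lemma maker_claims_snoc:
  "maker_claims (xs @ [x]) = (if even (length xs) then insert x (maker_claims xs) else maker_claims xs)"
proof -
  have "{i. i < length (xs @ [x]) \<and> even i} =
      (if even (length xs) then insert (length xs) {i. i < length xs \<and> even i}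
       else {i. i < length xs \<and> even i})"
    by (auto simp: less_Suc_eq)
  moreover have "(!) (xs @ [x]) ` {i. i < length xs \<and> even i} = (!) xs ` {i. i < length xs \<and> even i}"
    by (rule image_cong) (auto simp: nth_append)
  ultimately show ?thesis by (simp add: maker_claims_def setcompr_eq_image)
qed

lemma breaker_claims_snoc:
  "breaker_claims (xs @ [x]) = (if odd (length xs) then insert x (breaker_claims xs) else breaker_claims xs)"
proof -
  have "{i. i < length (xs @ [x]) \<and> odd i} =
      (if odd (length xs) then insert (length xs) {i. i < length xs \<and> odd i}
       else {i. i < length xs \<and> odd i})"
    by (auto simp: less_Suc_eq)
  moreover have "(!) (xs @ [x]) ` {i. i < length xs \<and> odd i} = (!) xs ` {i. i < length xs \<and> odd i}"
    by (rule image_cong) (auto simp: nth_append)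
  ultimately show ?thesis by (simp add: breaker_claims_def setcompr_eq_image)
qed

lemma claims_Un: "maker_claims xs \<union> breaker_claims xs = set xs"
  unfolding maker_claims_def breaker_claims_def by (auto simp: set_conv_nth)

text \<open>The probability that Breaker completes \<open>B i\<close> if every unclaimed element is
  assigned by a fair coin.\<close>

definition danger :: "('i \<Rightarrow> 'e set) \<Rightarrow> 'e list \<Rightarrow> 'i \<Rightarrow> real" where
  "danger B h i = (if B i \<inter> maker_claims h \<noteq> {} then 0 else (1 / 2) ^ card (B i - breaker_claims h))"

lemma danger_nonneg: "0 \<le> danger B h i"
  by (simp add: danger_def)

lemma danger_maker:
  "even (length h) \<Longrightarrow> danger B (h @ [x]) i = (if x \<in> B i then 0 else danger B h i)"
  by (simp add: danger_def maker_claims_snoc breaker_claims_snoc)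

lemma danger_breaker:
  assumes "odd (length h)" "x \<notin> set h" "finite (B i)"
  shows "danger B (h @ [x]) i = (if x \<in> B i then 2 * danger B h i else danger B h i)"
proof (cases "x \<in> B i")
  case True
  have "x \<notin> breaker_claims h" using assms(2) claims_Un[of h] by auto
  then have "card (B i - breaker_claims h) = Suc (card (B i - insert x (breaker_claims h)))"
    using True assms(3) by (subst Diff_insert, intro card.remove) auto
  then show ?thesis
    using assms True by (simp add: danger_def maker_claims_snoc breaker_claims_snoc)
next
  case False
  then have "B i - insert x (breaker_claims h) = B i - breaker_claims h" by auto
  then show ?thesis
    using assms False by (simp add: danger_def maker_claims_snoc breaker_claims_snoc)
qed

text \<open>Maker takes an element \<open>x\<close> of largest value, that is, of largest total
  danger of the sets through it. This lowers the potential by the value of \<open>x\<close>, and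
  Breaker's reply \<open>y\<close> raises it by at most the value that \<open>y\<close> had before,
  which is no larger. So the potential stays below 1, whereas a set claimed entirely by Breaker
  would alone contribute 1.\<close>

lemma erdos_selfridge:
  fixes B :: "'i \<Rightarrow> 'e set"
  assumes X: "finite X" and F: "finite F" and B: "\<And>i. i \<in> F \<Longrightarrow> B i \<subseteq> X"
    and small: "(\<Sum>i\<in>F. (1 / 2 :: real) ^ card (B i)) < 1"
  shows "\<exists>\<sigma>. maker_strategy X \<sigma> \<and> (\<forall>xs. complete_play X xs \<and> follows \<sigma> xs \<longrightarrow>
    (\<forall>i\<in>F. B i \<inter> maker_claims xs \<noteq> {}))"
proof -
  define pot where "pot h = (\<Sum>i\<in>F. danger B h i)" for h
  define val where "val h x = (\<Sum>i | i \<in> F \<and> x \<in> B i. danger B h i)" for h x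
  define \<sigma> where "\<sigma> h = arg_max_on (val h) (X - set h)" for h
  \<comment> \<open>\<open>arg_max_on\<close> is a choice operator, so the existence of a maximum on
    the finite nonempty set of free elements has to be supplied.\<close>
  have \<sigma>: "\<sigma> h \<in> X - set h \<and> (\<forall>y\<in>X - set h. val h y \<le> val h (\<sigma> h))" if "set h \<subset> X" for h
  proof -
    have ne: "finite (X - set h)" "X - set h \<noteq> {}" using that X by auto
    then have "Max (val h ` (X - set h)) \<in> val h ` (X - set h)" by (intro Max_in) auto
    then obtain m where "m \<in> X - set h" "Max (val h ` (X - set h)) = val h m" by (elim imageE)
    moreover have "val h y \<le> Max (val h ` (X - set h))" if "y \<in> X - set h" for y
      using ne that by (intro Max_ge) auto
    ultimately have m: "m \<in> X - set h" "\<forall>y\<in>X - set h. val h y \<le> val h m" by auto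
    then have "is_arg_max (val h) (\<lambda>x. x \<in> X - set h) m"
      by (auto simp: is_arg_max_linorder)
    then have "is_arg_max (val h) (\<lambda>x. x \<in> X - set h) (\<sigma> h)"
      unfolding \<sigma>_def arg_max_on_def arg_max_def by (rule someI)
    then show ?thesis by (auto simp: is_arg_max_linorder)
  qed
  have pot_maker: "pot (h @ [x]) = pot h - val h x" if "even (length h)" for h x
  proof -
    have "pot (h @ [x]) = (\<Sum>i\<in>F. danger B h i - (if x \<in> B i then danger B h i else 0))"
      using that by (auto simp: pot_def danger_maker intro!: sum.cong)
    then show ?thesis by (simp add: pot_def val_def sum_subtractf sum.inter_filter F)
  qed
  have pot_breaker: "pot (h @ [x]) = pot h + val h x" if "odd (length h)" "x \<notin> set h" for h x
  proof -
    have "pot (h @ [x]) = (\<Sum>i\<in>F. danger B h i + (if x \<in> B i then danger B h i else 0))"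
      unfolding pot_def
    proof (rule sum.cong[OF refl])
      fix i assume "i \<in> F"
      then have "finite (B i)" using B X finite_subset by blast
      from danger_breaker[of h x B i, OF that this]
      show "danger B (h @ [x]) i = danger B h i + (if x \<in> B i then danger B h i else 0)" by simp
    qed
    then show ?thesis by (simp add: pot_def val_def sum.distrib sum.inter_filter F)
  qed
  have val_nonneg: "0 \<le> val h x" for h x by (simp add: val_def sum_nonneg danger_nonneg)
  have val_maker: "val (h @ [x]) y \<le> val h y" if "even (length h)" for h x y
    unfolding val_def using that by (intro sum_mono) (simp add: danger_maker danger_nonneg)
  have "maker_strategy X \<sigma>" using \<sigma> by (auto simp: maker_strategy_def)
  moreover have "\<forall>i\<in>F. B i \<inter> maker_claims xs \<noteq> {}"
    if play: "complete_play X xs" and fol: "follows \<sigma> xs" for xs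
  proof -
    have dist: "distinct xs" and setxs: "set xs = X" using play by (auto simp: complete_play_def)
    have take_snoc: "take (Suc k) xs = take k xs @ [xs ! k]" if "k < length xs" for k
      using that by (rule take_Suc_conv_app_nth)
    have sub: "set (take k xs) \<subset> X" "xs ! k \<in> X - set (take k xs)" if "k < length xs" for k
    proof -
      have "xs ! k \<notin> set (take k xs)"
        using distinct_take[OF dist, of "Suc k"] take_snoc[OF that] by simp
      then show "xs ! k \<in> X - set (take k xs)" using setxs that by auto
      then show "set (take k xs) \<subset> X" using setxs set_take_subset[of k xs] by auto
    qed
    \<comment> \<open>Only positions with Maker to move are compared, since a move of Breaker alone
      may raise the potential.\<close>
    have even_pot: "pot (take (2 * k) xs) < 1" if "2 * k \<le> length xs" for k
      using that
    proof (induction k)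
      case 0
      have "pot [] = (\<Sum>i\<in>F. (1 / 2) ^ card (B i))"
        by (simp add: pot_def danger_def maker_claims_def breaker_claims_def)
      then show ?case using small by simp
    next
      case (Suc k)
      let ?h = "take (2 * k) xs" and ?x = "xs ! (2 * k)" and ?y = "xs ! (Suc (2 * k))"
      have lt: "2 * k < length xs" "Suc (2 * k) < length xs" using Suc.prems by auto
      have len: "length ?h = 2 * k" using lt by simp
      have x: "?x = \<sigma> ?h" using fol lt by (simp add: follows_def)
      have y: "?y \<in> X - set (?h @ [?x])" using sub(2)[OF lt(2)] take_snoc[OF lt(1)] by simp
      have "take (2 * Suc k) xs = (?h @ [?x]) @ [?y]"
        using take_snoc[OF lt(1)] take_snoc[OF lt(2)] by simp
      then have "pot (take (2 * Suc k) xs) = pot ?h - val ?h ?x + val (?h @ [?x]) ?y"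
        using pot_breaker[of "?h @ [?x]" ?y] pot_maker[of ?h ?x] y len by simp
      moreover have "val (?h @ [?x]) ?y \<le> val ?h ?y" using val_maker[of ?h ?x ?y] len by simp
      moreover have "val ?h ?y \<le> val ?h ?x" using \<sigma>[OF sub(1)[OF lt(1)]] x y by simp
      ultimately show ?case using Suc by simp
    qed
    have "pot xs < 1"
    proof (cases "even (length xs)")
      case True
      then show ?thesis using even_pot[of "length xs div 2"] by simp
    next
      case False
      \<comment> \<open>On a board of odd size Maker also makes the last, unanswered move, which
        cannot raise the potential.\<close>
      then obtain k where k: "length xs = Suc (2 * k)" by (metis oddE Suc_eq_plus1)
      have "xs = take (2 * k) xs @ [xs ! (2 * k)]" using take_snoc[of "2 * k"] k by simp
      then have "pot xs = pot (take (2 * k) xs) - val (take (2 * k) xs) (xs ! (2 * k))"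
        using pot_maker[of "take (2 * k) xs" "xs ! (2 * k)"] k by simp
      then show ?thesis using even_pot[of k] k val_nonneg[of "take (2 * k) xs" "xs ! (2 * k)"] by simp
    qed
    show ?thesis
    proof (intro ballI notI)
      fix i assume i: "i \<in> F" and "B i \<inter> maker_claims xs = {}"
      then have "B i - breaker_claims xs = {}" using B[OF i] setxs claims_Un[of xs] by auto
      then have "card (B i - breaker_claims xs) = 0" by (simp only: card.empty)
      then have "danger B xs i = 1" using \<open>B i \<inter> _ = {}\<close> by (simp only: danger_def power_0 if_False simp_thms)
      moreover have "danger B xs i \<le> pot xs"
        unfolding pot_def using i F by (intro member_le_sum danger_nonneg) auto
      ultimately show False using \<open>pot xs < 1\<close> by simp
    qed
  qed
  ultimately show ?thesis by blast
qed

section \<open>The game on the random graph\<close>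

lemma finite_all_edges: "finite W \<Longrightarrow> finite (all_edges W)"
  by (rule finite_subset[of _ "Pow W"]) (auto simp: all_edges_def)

lemma card_all_edges:
  assumes "finite W"
  shows "card (all_edges W) = card W choose 2"
  unfolding all_edges_def using n_subsets[OF assms, of 2] by simp

lemma card_all_edges_bounds:
  assumes "n \<ge> 2"
  shows "real n ^ 2 / 4 \<le> card (all_edges {..<n})" "real (card (all_edges {..<n})) \<le> real n ^ 2"
    "0 < card (all_edges {..<n})"
proof -
  have eq: "real (card (all_edges {..<n})) = real n * (real n - 1) / 2"
    using assms by (simp add: card_all_edges choose_two real_of_nat_div of_nat_diff)
  have "real n * (real n / 2) \<le> real n * (real n - 1)"
    using assms by (intro mult_left_mono) auto
  then show lower: "real n ^ 2 / 4 \<le> card (all_edges {..<n})" by (simp add: eq power2_eq_square)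
  have "real n * ((real n - 1) / 2) \<le> real n * real n" using assms by (intro mult_left_mono) auto
  then show "real (card (all_edges {..<n})) \<le> real n ^ 2" by (simp add: eq power2_eq_square)
  have "0 < real n ^ 2 / 4" using assms by simp
  with lower have "0 < real (card (all_edges {..<n}))" by linarith
  then show "0 < card (all_edges {..<n})" by simp
qed

text \<open>The Erdos-Selfridge sum for the undisturbed board \<open>S\<close>. Since
  \<open>T\<close> ranges over subsets of \<open>S\<close> only, each \<open>T\<close> brings a
  factor \<open>p ^ card T\<close> when \<open>S\<close> is random.\<close>

definition container_weight :: "('v set \<Rightarrow> 'v set) \<Rightarrow> nat \<Rightarrow> 'v set \<Rightarrow> real" where
  "container_weight C t S = (\<Sum>T | T \<subseteq> S \<and> card T \<le> t. (1 / 2) ^ card (S - C T))"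

text \<open>The weight does not depend on \<open>R\<close>, and the indices
  \<open>T \<subseteq> S - R\<close> are among those summed for \<open>S\<close>. So one bound
  handles all deletions simultaneously, without a union bound over \<open>R\<close>.\<close>

lemma maker_wins_if_container_weight_small:
  assumes S: "S \<subseteq> V" "finite V" and R: "R \<subseteq> S"
    and C: "\<And>I. I \<subseteq> V \<Longrightarrow> \<not> contains_copy H (W, I) \<Longrightarrow> I \<subseteq> C I"
    and fingerprint: "\<And>I. I \<subseteq> V \<Longrightarrow> \<exists>T. card T \<le> t \<and> fingerprint C T I"
    and small: "2 ^ card R * container_weight C t S < 1"
  shows "maker_wins_H_game H (W, S - R)"
proof -
  let ?X = "S - R" and ?F = "{T. T \<subseteq> S - R \<and> card T \<le> t}"
  have fS: "finite S" using S finite_subset by auto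
  have fR: "finite R" using R fS finite_subset by auto
  have "(\<Sum>T\<in>?F. (1 / 2 :: real) ^ card (?X - C T))
      \<le> (\<Sum>T\<in>?F. 2 ^ card R * (1 / 2) ^ card (S - C T))"
  proof (rule sum_mono)
    fix T
    have "card (S - C T) \<le> card ((?X - C T) \<union> R)" using fS fR by (intro card_mono) auto
    also have "\<dots> \<le> card (?X - C T) + card R" by (rule card_Un_le)
    finally have "(1 / 2 :: real) ^ (card (?X - C T) + card R) \<le> (1 / 2) ^ card (S - C T)"
      by (intro power_decreasing) auto
    then have "2 ^ card R * (1 / 2 :: real) ^ (card (?X - C T) + card R)
        \<le> 2 ^ card R * (1 / 2) ^ card (S - C T)" by simp
    then show "(1 / 2 :: real) ^ card (?X - C T) \<le> 2 ^ card R * (1 / 2) ^ card (S - C T)"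
      by (simp add: power_add power_one_over)
  qed
  also have "\<dots> \<le> (\<Sum>T | T \<subseteq> S \<and> card T \<le> t. 2 ^ card R * (1 / 2) ^ card (S - C T))"
    using fS by (intro sum_mono2) auto
  also have "\<dots> < 1" using small by (simp add: container_weight_def sum_distrib_left)
  finally have "(\<Sum>T\<in>?F. (1 / 2 :: real) ^ card (?X - C T)) < 1" .
  then have "\<exists>\<sigma>. maker_strategy ?X \<sigma> \<and> (\<forall>xs. complete_play ?X xs \<and> follows \<sigma> xs \<longrightarrow>
      (\<forall>T\<in>?F. (?X - C T) \<inter> maker_claims xs \<noteq> {}))"
    using fS by (intro erdos_selfridge) auto
  then obtain \<sigma> where \<sigma>: "maker_strategy ?X \<sigma>" "\<forall>xs. complete_play ?X xs \<and> follows \<sigma> xs \<longrightarrow>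
      (\<forall>T\<in>?F. (?X - C T) \<inter> maker_claims xs \<noteq> {})"
    by (elim exE conjE)
  have "contains_copy H (W, maker_claims xs)" if "complete_play ?X xs" "follows \<sigma> xs" for xs
  proof (rule ccontr)
    let ?M = "maker_claims xs"
    assume free: "\<not> contains_copy H (W, ?M)"
    have "?M \<subseteq> set xs" by (auto simp: maker_claims_def)
    moreover have "set xs = ?X" using that(1) by (simp add: complete_play_def)
    ultimately have M: "?M \<subseteq> ?X" by simp
    then have MV: "?M \<subseteq> V" using S by auto
    obtain T where T: "card T \<le> t" "fingerprint C T ?M" using fingerprint[OF MV] by blast
    have TM: "T \<subseteq> ?M" using T by (simp add: fingerprint_def)
    have "C T = C ?M" using fingerprintD[OF T(2) order_refl TM] .
    then have "?M \<subseteq> C T" using C[OF MV free] by simp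
    moreover have "T \<in> ?F" using T TM M by auto
    then have "(?X - C T) \<inter> ?M \<noteq> {}" using \<sigma>(2)[rule_format, OF conjI[OF that]] by blast
    ultimately show False by blast
  qed
  then show ?thesis unfolding maker_wins_H_game_def using \<sigma>(1) by auto
qed

section \<open>First moment of the container weight\<close>

lemma finite_set_pmf_random_subset:
  "finite V \<Longrightarrow> finite (set_pmf (Pi_pmf V False (\<lambda>_. bernoulli_pmf p)))"
  by (rule finite_subset[OF set_Pi_pmf_subset']) auto

text \<open>The variable is dominated by a product of independent factors \<open>h e (f e)\<close>:
  an element of \<open>T\<close> has mean \<open>p\<close>, an element outside
  \<open>T \<union> B\<close> has mean \<open>(1 - p) + p / 2\<close>. It is only dominated because
  elements of \<open>T - B\<close> lose their factor 1/2. At least a proportion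
  \<open>\<delta>\<close> of \<open>V\<close> lies outside \<open>B\<close>, and \<open>T\<close>
  takes away at most half of that.\<close>

lemma expectation_container_weight_term:
  fixes p \<delta> :: real
  assumes V: "finite V" and p: "0 \<le> p" "p \<le> 1" and T: "T \<subseteq> V" and B: "B \<subseteq> V"
    and \<delta>: "card B \<le> (1 - \<delta>) * card V" "card T \<le> \<delta> / 2 * card V"
  shows "measure_pmf.expectation (Pi_pmf V False (\<lambda>_. bernoulli_pmf p))
      (\<lambda>f. if T \<subseteq> {e \<in> V. f e} then (1 / 2) ^ card ({e \<in> V. f e} - B) else 0)
    \<le> p ^ card T * exp (- \<delta> / 4 * card V * p)"
proof -
  let ?P = "Pi_pmf V False (\<lambda>_. bernoulli_pmf p)"
  define h :: "'a \<Rightarrow> bool \<Rightarrow> real" where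
    "h e b = (if e \<in> T then of_bool b else if b \<and> e \<notin> B then 1 / 2 else 1)" for e b
  have int: "integrable (measure_pmf ?P) g" for g :: "_ \<Rightarrow> real"
    by (rule integrable_measure_pmf_finite[OF finite_set_pmf_random_subset[OF V]])
  have "measure_pmf.expectation ?P
      (\<lambda>f. if T \<subseteq> {e \<in> V. f e} then (1 / 2) ^ card ({e \<in> V. f e} - B) else 0)
    \<le> measure_pmf.expectation ?P (\<lambda>f. \<Prod>e\<in>V. h e (f e))"
  proof (rule integral_mono[OF int int])
    fix f
    show "(if T \<subseteq> {e \<in> V. f e} then (1 / 2) ^ card ({e \<in> V. f e} - B) else 0) \<le> (\<Prod>e\<in>V. h e (f e))"
    proof (cases "T \<subseteq> {e \<in> V. f e}")
      case True
      have "(1 / 2 :: real) ^ card ({e \<in> V. f e} - B) = (\<Prod>e\<in>{e \<in> V. f e} - B. 1 / 2)" by simp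
      also have "\<dots> = (\<Prod>e\<in>V. if e \<in> {e \<in> V. f e} - B then 1 / 2 else 1)"
        using V by (subst prod.inter_restrict[symmetric])
          (auto intro!: arg_cong[where f = "\<lambda>A. (1 / 2) ^ card A"])
      also have "\<dots> \<le> (\<Prod>e\<in>V. h e (f e))"
        using True by (intro prod_mono) (auto simp: h_def)
      finally show ?thesis using True by simp
    next
      case False
      have "0 \<le> (\<Prod>e\<in>V. h e (f e))" by (intro prod_nonneg) (simp add: h_def)
      then show ?thesis using False by simp
    qed
  qed
  also have "\<dots> = (\<Prod>e\<in>V. measure_pmf.expectation (bernoulli_pmf p) (h e))"
    using V by (intro expectation_prod_Pi_pmf integrable_measure_pmf_finite) (auto simp: h_def)
  also have "\<dots> = (\<Prod>e\<in>V. if e \<in> T then p else if e \<in> B then 1 else 1 - p / 2)"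
    using p by (intro prod.cong) (auto simp: h_def)
  also have "\<dots> = (\<Prod>e\<in>V. (if e \<in> T then p else 1) * (if e \<in> V - (T \<union> B) then 1 - p / 2 else 1))"
    by (intro prod.cong) auto
  also have "\<dots> = (\<Prod>e\<in>V. if e \<in> T then p else 1) * (\<Prod>e\<in>V. if e \<in> V - (T \<union> B) then 1 - p / 2 else 1)"
    by (rule prod.distrib)
  also have "(\<Prod>e\<in>V. if e \<in> T then p else 1) = p ^ card T"
  proof -
    have "V \<inter> T = T" using T by auto
    then show ?thesis by (subst prod.inter_restrict[OF V, symmetric]) simp
  qed
  also have "(\<Prod>e\<in>V. if e \<in> V - (T \<union> B) then 1 - p / 2 else 1) = (1 - p / 2) ^ card (V - (T \<union> B))"
  proof -
    have "V \<inter> (V - (T \<union> B)) = V - (T \<union> B)" by auto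
    then show ?thesis by (subst prod.inter_restrict[OF V, symmetric]) simp
  qed
  also have "(1 - p / 2) ^ card (V - (T \<union> B)) \<le> exp (- p / 2) ^ card (V - (T \<union> B))"
    using exp_ge_add_one_self[of "- p / 2"] p by (intro power_mono) auto
  also have "\<dots> = exp (- (p / 2) * card (V - (T \<union> B)))"
    by (simp flip: exp_of_nat_mult)
  also have "\<dots> \<le> exp (- \<delta> / 4 * card V * p)"
  proof -
    have "card V \<le> card ((V - (T \<union> B)) \<union> (T \<union> B))"
      using V T B by (intro card_mono) (auto intro: finite_subset)
    also have "\<dots> \<le> card (V - (T \<union> B)) + (card T + card B)"
      using card_Un_le[of "V - (T \<union> B)" "T \<union> B"] card_Un_le[of T B] by linarith
    finally have "real (card V) \<le> card (V - (T \<union> B)) + (real (card T) + real (card B))" by linarith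
    then have "\<delta> / 2 * card V \<le> card (V - (T \<union> B))" using \<delta> by (simp add: algebra_simps)
    from mult_left_mono[OF this p(1)] show ?thesis by (simp add: algebra_simps)
  qed
  finally show ?thesis using p by (simp add: mult_left_mono)
qed

text \<open>Exponential tilting in place of binomial estimates: \<open>p ^ card T\<close> is at most
  \<open>(1 / l) ^ t * (l * p) ^ card T\<close> for the sets in question, and summing this over all
  subsets gives a power of \<open>1 + l * p\<close>.\<close>

lemma sum_power_card_le:
  fixes p l :: real
  assumes V: "finite V" and p: "0 \<le> p" and l: "0 < l" "l \<le> 1"
  shows "(\<Sum>T | T \<subseteq> V \<and> card T \<le> t. p ^ card T) \<le> (1 / l) ^ t * exp (l * p * card V)"
proof -
  have "(\<Sum>T | T \<subseteq> V \<and> card T \<le> t. p ^ card T)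
      \<le> (\<Sum>T | T \<subseteq> V \<and> card T \<le> t. (1 / l) ^ t * (l * p) ^ card T)"
  proof (rule sum_mono)
    fix T assume T: "T \<in> {T. T \<subseteq> V \<and> card T \<le> t}"
    have "p ^ card T = (1 / l) ^ card T * (l * p) ^ card T"
      using l by (simp flip: power_mult_distrib)
    also have "\<dots> \<le> (1 / l) ^ t * (l * p) ^ card T"
      using T l p by (intro mult_right_mono power_increasing) auto
    finally show "p ^ card T \<le> (1 / l) ^ t * (l * p) ^ card T" .
  qed
  also have "\<dots> \<le> (\<Sum>T\<in>Pow V. (1 / l) ^ t * (l * p) ^ card T)"
    using V l p by (intro sum_mono2) auto
  also have "\<dots> = (1 / l) ^ t * (\<Prod>e\<in>V. l * p + 1)"
    by (subst prod_add[OF V]) (simp add: sum_distrib_left)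
  also have "\<dots> = (1 / l) ^ t * (1 + l * p) ^ card V" by (simp add: add.commute)
  also have "(1 + l * p) ^ card V \<le> exp (l * p) ^ card V"
    using l p exp_ge_add_one_self[of "l * p"] by (intro power_mono) auto
  also have "exp (l * p) ^ card V = exp (l * p * card V)"
    by (simp add: mult.commute flip: exp_of_nat_mult)
  finally show ?thesis using l by (simp add: mult_left_mono)
qed

lemma expectation_container_weight:
  fixes p \<delta> \<epsilon> :: real
  assumes V: "finite V" and p: "0 \<le> p" "p \<le> 1" and \<delta>: "0 < \<delta>" "\<delta> \<le> 1"
    and C: "\<And>I. I \<subseteq> V \<Longrightarrow> C I \<subseteq> V \<and> card (C I) \<le> (1 - \<delta>) * card V"
    and t: "t \<le> \<epsilon> * card V * p" and \<epsilon>: "0 \<le> \<epsilon>" "\<epsilon> \<le> \<delta> / 2" "\<epsilon> * ln (16 / \<delta>) \<le> \<delta> / 16"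
  shows "measure_pmf.expectation (Pi_pmf V False (\<lambda>_. bernoulli_pmf p))
      (\<lambda>f. container_weight C t {e \<in> V. f e}) \<le> exp (- \<delta> / 8 * card V * p)"
proof -
  let ?P = "Pi_pmf V False (\<lambda>_. bernoulli_pmf p)" and ?N = "real (card V)"
  let ?F = "{T. T \<subseteq> V \<and> card T \<le> t}"
  have int: "integrable (measure_pmf ?P) g" for g :: "_ \<Rightarrow> real"
    by (rule integrable_measure_pmf_finite[OF finite_set_pmf_random_subset[OF V]])
  have fF: "finite ?F" using V by simp
  have split: "container_weight C t {e \<in> V. f e} =
      (\<Sum>T\<in>?F. if T \<subseteq> {e \<in> V. f e} then (1 / 2) ^ card ({e \<in> V. f e} - C T) else 0)" for f
  proof -
    have "{T. T \<subseteq> {e \<in> V. f e} \<and> card T \<le> t} = {T \<in> ?F. T \<subseteq> {e \<in> V. f e}}" by auto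
    then show ?thesis unfolding container_weight_def by (simp only: sum.inter_filter[OF fF])
  qed
  have "?N * p \<le> ?N" using p by (simp add: mult_left_le)
  then have "\<epsilon> * (?N * p) \<le> \<delta> / 2 * ?N" using \<epsilon> p by (intro mult_mono) auto
  then have t2: "t \<le> \<delta> / 2 * ?N" using t by (simp add: mult.assoc)
  have "measure_pmf.expectation ?P (\<lambda>f. container_weight C t {e \<in> V. f e}) =
      (\<Sum>T\<in>?F. measure_pmf.expectation ?P
         (\<lambda>f. if T \<subseteq> {e \<in> V. f e} then (1 / 2) ^ card ({e \<in> V. f e} - C T) else 0))"
    unfolding split by (rule Bochner_Integration.integral_sum[OF int])
  also have "\<dots> \<le> (\<Sum>T\<in>?F. p ^ card T * exp (- \<delta> / 4 * ?N * p))"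
  proof (rule sum_mono)
    fix T assume T: "T \<in> ?F"
    then have "real (card T) \<le> \<delta> / 2 * ?N" using t2 by (simp add: order_trans[of _ "real t"])
    then show "measure_pmf.expectation ?P
         (\<lambda>f. if T \<subseteq> {e \<in> V. f e} then (1 / 2) ^ card ({e \<in> V. f e} - C T) else 0)
        \<le> p ^ card T * exp (- \<delta> / 4 * ?N * p)"
      using T C[of T] V p by (intro expectation_container_weight_term) auto
  qed
  also have "\<dots> = (\<Sum>T\<in>?F. p ^ card T) * exp (- \<delta> / 4 * ?N * p)"
    by (simp add: sum_distrib_right)
  \<comment> \<open>The tilt \<open>l = \<delta> / 16\<close> costs \<open>\<delta> / 16\<close> in
    the exponent, and by the choice of \<open>\<epsilon>\<close> so does
    \<open>(16 / \<delta>) ^ t\<close>. Of the gain \<open>\<delta> / 4\<close> there remains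
    \<open>\<delta> / 8\<close>.\<close>
  also have "\<dots> \<le> ((1 / (\<delta> / 16)) ^ t * exp (\<delta> / 16 * p * ?N)) * exp (- \<delta> / 4 * ?N * p)"
    using V p \<delta> by (intro mult_right_mono sum_power_card_le) auto
  also have "(1 / (\<delta> / 16)) ^ t = exp (t * ln (16 / \<delta>))"
    using \<delta> by (simp add: exp_of_nat_mult)
  also have "\<dots> \<le> exp (\<delta> / 16 * (?N * p))"
  proof -
    have "t * ln (16 / \<delta>) \<le> \<epsilon> * ?N * p * ln (16 / \<delta>)"
      using t \<delta> by (intro mult_right_mono) auto
    also have "\<dots> = (\<epsilon> * ln (16 / \<delta>)) * (?N * p)" by simp
    also have "\<dots> \<le> \<delta> / 16 * (?N * p)" using \<epsilon> p by (intro mult_right_mono) auto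
    finally show ?thesis by simp
  qed
  also have "exp (\<delta> / 16 * (?N * p)) * exp (\<delta> / 16 * p * ?N) * exp (- \<delta> / 4 * ?N * p)
      = exp (- \<delta> / 8 * ?N * p)"
    by (simp add: algebra_simps flip: exp_add)
  finally show ?thesis by (simp add: mult_right_mono)
qed

text \<open>As there are at least \<open>n^2 / 4\<close> pairs, the expected weight is at most
  \<open>exp (- \<delta> / 32 * x)\<close> with \<open>x = n^2 * p\<close>. Markov's inequality is
  applied at the level \<open>exp (- \<delta> / 64 * x)\<close>: half of the exponent becomes the
  failure probability, the other half absorbs \<open>2 ^ card R\<close>, which is at most
  \<open>exp (card R)\<close>. This explains the two occurrences of
  \<open>\<delta> / 64\<close>.\<close>

lemma prob_maker_wins:
  fixes p \<delta> \<epsilon> :: real and H :: "'a graph"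
  defines "V \<equiv> \<lambda>n. all_edges {..<n}"
  assumes n: "n \<ge> 2" and p: "0 \<le> p" "p \<le> 1" and \<delta>: "0 < \<delta>" "\<delta> \<le> 1"
    and cont: "containers (V n) {} (V n) t ((1 - \<delta>) * card (V n)) (\<lambda>I. \<not> contains_copy H ({..<n}, I))"
    and t: "t \<le> \<epsilon> * card (V n) * p" and \<epsilon>: "0 \<le> \<epsilon>" "\<epsilon> \<le> \<delta> / 2" "\<epsilon> * ln (16 / \<delta>) \<le> \<delta> / 16"
  shows "measure_pmf.prob (Gnp n p)
      {G. \<forall>R \<subseteq> snd G. real (card R) \<le> \<delta> / 64 * real n ^ 2 * p \<longrightarrow>
            maker_wins_H_game H (fst G, snd G - R)}
    \<ge> 1 - exp (- (\<delta> / 64) * real n ^ 2 * p)"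
proof -
  let ?P = "Pi_pmf (V n) False (\<lambda>_. bernoulli_pmf p)"
  have V: "finite (V n)" by (simp add: V_def finite_all_edges)
  from cont have "\<exists>C. \<forall>I\<subseteq>V n. C I \<subseteq> V n \<and> real (card (C I)) \<le> (1 - \<delta>) * card (V n) \<and>
      (\<not> contains_copy H ({..<n}, I) \<longrightarrow> I \<subseteq> C I) \<and> (\<exists>T. card T \<le> t \<and> fingerprint C T I)"
    unfolding containers_def by simp
  then obtain C where "\<forall>I\<subseteq>V n. C I \<subseteq> V n \<and> real (card (C I)) \<le> (1 - \<delta>) * card (V n) \<and>
      (\<not> contains_copy H ({..<n}, I) \<longrightarrow> I \<subseteq> C I) \<and> (\<exists>T. card T \<le> t \<and> fingerprint C T I)"
    by (elim exE)
  then have C: "\<And>I. I \<subseteq> V n \<Longrightarrow> C I \<subseteq> V n \<and> real (card (C I)) \<le> (1 - \<delta>) * card (V n)"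
      "\<And>I. I \<subseteq> V n \<Longrightarrow> \<not> contains_copy H ({..<n}, I) \<Longrightarrow> I \<subseteq> C I"
      "\<And>I. I \<subseteq> V n \<Longrightarrow> \<exists>T. card T \<le> t \<and> fingerprint C T I"
    by simp_all
  define x where "x = real n ^ 2 * p"
  have x: "0 \<le> x" using p by (simp add: x_def)
  let ?Y = "\<lambda>f. container_weight C t {e \<in> V n. f e}"
  let ?good = "{f. ?Y f < exp (- \<delta> / 64 * x)}" and ?bad = "{f. exp (- \<delta> / 64 * x) \<le> ?Y f}"
  have int: "integrable (measure_pmf ?P) g" for g :: "_ \<Rightarrow> real"
    by (rule integrable_measure_pmf_finite[OF finite_set_pmf_random_subset[OF V]])
  have Y0: "0 \<le> ?Y f" for f by (simp add: container_weight_def sum_nonneg)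
  have card: "x / 4 \<le> card (V n) * p"
  proof -
    have "real n ^ 2 / 4 \<le> card (V n)" using card_all_edges_bounds(1)[OF n] by (simp add: V_def)
    then have "real n ^ 2 / 4 * p \<le> card (V n) * p" using p by (intro mult_right_mono) auto
    then show ?thesis by (simp add: x_def)
  qed
  have "measure_pmf.prob ?P ?bad = measure_pmf.expectation ?P (indicator ?bad)" by simp
  also have "\<dots> \<le> measure_pmf.expectation ?P (\<lambda>f. exp (\<delta> / 64 * x) * ?Y f)"
  proof (rule integral_mono[OF int int])
    fix f
    show "indicator ?bad f \<le> exp (\<delta> / 64 * x) * ?Y f"
    proof (cases "f \<in> ?bad")
      case True
      then have "exp (\<delta> / 64 * x) * exp (- \<delta> / 64 * x) \<le> exp (\<delta> / 64 * x) * ?Y f" by simp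
      then show ?thesis using True by (simp flip: exp_add)
    qed (use Y0 in auto)
  qed
  also have "\<dots> = exp (\<delta> / 64 * x) * measure_pmf.expectation ?P ?Y" by simp
  also have "measure_pmf.expectation ?P ?Y \<le> exp (- \<delta> / 8 * card (V n) * p)"
    by (rule expectation_container_weight[OF V p \<delta> C(1) t \<epsilon>])
  also have "\<dots> \<le> exp (- \<delta> / 32 * x)"
    using mult_left_mono[OF card, of "\<delta> / 8"] \<delta> by (simp add: algebra_simps)
  finally have "measure_pmf.prob ?P ?bad \<le> exp (\<delta> / 64 * x) * exp (- \<delta> / 32 * x)" by simp
  also have "\<dots> = exp (- (\<delta> / 64) * x)" by (simp flip: exp_add)
  finally have bad: "measure_pmf.prob ?P ?bad \<le> exp (- (\<delta> / 64) * x)" .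
  have "?good = UNIV - ?bad" by auto
  then have "measure_pmf.prob ?P ?good = 1 - measure_pmf.prob ?P ?bad"
    using measure_pmf.prob_compl[of ?bad ?P] by simp
  then have "1 - exp (- (\<delta> / 64) * x) \<le> measure_pmf.prob ?P ?good" using bad by simp
  also have "\<dots> \<le> measure_pmf.prob ?P ((\<lambda>f. ({..<n}, {e \<in> V n. f e})) -`
      {G. \<forall>R \<subseteq> snd G. real (card R) \<le> \<delta> / 64 * real n ^ 2 * p \<longrightarrow>
            maker_wins_H_game H (fst G, snd G - R)})"
  proof (rule measure_pmf.finite_measure_mono)
    show "?good \<subseteq> (\<lambda>f. ({..<n}, {e \<in> V n. f e})) -`
      {G. \<forall>R \<subseteq> snd G. real (card R) \<le> \<delta> / 64 * real n ^ 2 * p \<longrightarrow>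
            maker_wins_H_game H (fst G, snd G - R)}"
    proof (rule subsetI, simp only: vimage_eq mem_Collect_eq fst_conv snd_conv, intro allI impI)
      fix f R assume f: "?Y f < exp (- \<delta> / 64 * x)" and R: "R \<subseteq> {e \<in> V n. f e}"
        "real (card R) \<le> \<delta> / 64 * (real n)\<^sup>2 * p"
      have "2 ^ card R \<le> exp (1 :: real) ^ card R"
        using exp_ge_add_one_self[of 1] by (intro power_mono) auto
      also have "\<dots> = exp (card R)" by (simp flip: exp_of_nat_mult)
      also have "\<dots> \<le> exp (\<delta> / 64 * x)" using R(2) by (simp add: x_def mult.assoc)
      finally have "2 ^ card R * ?Y f \<le> exp (\<delta> / 64 * x) * ?Y f" using Y0 by (intro mult_right_mono)
      also have "\<dots> < exp (\<delta> / 64 * x) * exp (- \<delta> / 64 * x)" using f by simp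
      also have "\<dots> = 1" by (simp flip: exp_add)
      finally show "maker_wins_H_game H ({..<n}, {e \<in> V n. f e} - R)"
        using V R(1) C by (intro maker_wins_if_container_weight_small[where V = "V n"]) auto
    qed
  qed auto
  finally show ?thesis by (simp add: Gnp_def x_def V_def mult.assoc)
qed

section \<open>Containers for copies of a graph\<close>

definition embeddings :: "'a graph \<Rightarrow> nat \<Rightarrow> ('a \<Rightarrow> nat) set" where
  "embeddings H n = {\<phi> \<in> fst H \<rightarrow>\<^sub>E {..<n}. inj_on \<phi> (fst H)}"

definition copy_edges :: "'a graph \<Rightarrow> ('a \<Rightarrow> 'b) \<Rightarrow> 'b set set" where
  "copy_edges H \<phi> = (\<lambda>e. \<phi> ` e) ` snd H"

text \<open>Counting embeddings instead of subgraphs turns codegrees into plain counts of maps;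
  automorphisms and isolated vertices of \<open>H\<close> merely add multiplicity.\<close>

definition copy_weight :: "'a graph \<Rightarrow> nat \<Rightarrow> nat set set \<Rightarrow> real" where
  "copy_weight H n F = card {\<phi> \<in> embeddings H n. copy_edges H \<phi> = F}"

lemma finite_simple_graphD:
  assumes "finite_simple_graph H"
  shows "finite (fst H)" "finite (snd H)" "e \<in> snd H \<Longrightarrow> e \<subseteq> fst H" "e \<in> snd H \<Longrightarrow> card e = 2"
proof -
  show *: "finite (fst H)" using assms by (simp add: finite_simple_graph_def)
  show "finite (snd H)"
    using assms finite_all_edges[OF *] by (auto simp: finite_simple_graph_def intro: finite_subset)
  show "e \<in> snd H \<Longrightarrow> e \<subseteq> fst H" "e \<in> snd H \<Longrightarrow> card e = 2"
    using assms by (auto simp: finite_simple_graph_def all_edges_def)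
qed

lemma finite_embeddings: "finite (fst H) \<Longrightarrow> finite (embeddings H n)"
  unfolding embeddings_def by (rule finite_subset[of _ "fst H \<rightarrow>\<^sub>E {..<n}"]) (auto intro: finite_PiE)

text \<open>Each factor of the falling factorial is at least \<open>n / 2\<close>.\<close>

lemma card_embeddings_ge:
  assumes "finite (fst H)" "2 * card (fst H) \<le> n"
  shows "(real n / 2) ^ card (fst H) \<le> card (embeddings H n)"
proof -
  have "(real n / 2) ^ card (fst H) = (\<Prod>i<card (fst H). real n / 2)" by simp
  also have "\<dots> \<le> (\<Prod>i<card (fst H). real (n - i))"
    using assms(2) by (intro prod_mono) (auto simp: of_nat_diff)
  also have "\<dots> = real (card (embeddings H n))"
    unfolding embeddings_def
    by (subst card_inj_on_subset_funcset) (use assms in \<open>auto simp: atLeast0LessThan of_nat_prod\<close>)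
  finally show ?thesis .
qed

lemma inj_on_copy_edges:
  assumes "finite_simple_graph H" "\<phi> \<in> embeddings H n"
  shows "inj_on (\<lambda>e. \<phi> ` e) (snd H)"
proof (rule inj_on_subset)
  show "inj_on ((`) \<phi>) (Pow (fst H))"
    using assms(2) by (intro inj_on_image_Pow) (simp add: embeddings_def)
  show "snd H \<subseteq> Pow (fst H)" using finite_simple_graphD(3)[OF assms(1)] by auto
qed

lemma card_copy_edges:
  "finite_simple_graph H \<Longrightarrow> \<phi> \<in> embeddings H n \<Longrightarrow> card (copy_edges H \<phi>) = card (snd H)"
  unfolding copy_edges_def by (intro card_image inj_on_copy_edges)

lemma copy_edges_subset:
  assumes H: "finite_simple_graph H" and \<phi>: "\<phi> \<in> embeddings H n"
  shows "copy_edges H \<phi> \<subseteq> all_edges {..<n}"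
proof
  fix f assume "f \<in> copy_edges H \<phi>"
  then obtain e where e: "e \<in> snd H" "f = \<phi> ` e" by (auto simp: copy_edges_def)
  have sub: "e \<subseteq> fst H" and c: "card e = 2" using finite_simple_graphD[OF H] e(1) by auto
  have "inj_on \<phi> e" using \<phi> sub inj_on_subset by (auto simp: embeddings_def)
  then have "card f = 2" using c e by (simp add: card_image)
  moreover have "f \<subseteq> {..<n}" using \<phi> sub e by (auto simp: embeddings_def)
  ultimately show "f \<in> all_edges {..<n}" by (simp add: all_edges_def)
qed

lemma codegree_copy_weight:
  assumes H: "finite_simple_graph H"
  shows "codegree (all_edges {..<n}) (copy_weight H n) \<sigma> =
    card {\<phi> \<in> embeddings H n. \<sigma> \<subseteq> copy_edges H \<phi>}"
proof -
  let ?T = "{e. e \<subseteq> all_edges {..<n} \<and> \<sigma> \<subseteq> e}" and ?S = "{\<phi> \<in> embeddings H n. \<sigma> \<subseteq> copy_edges H \<phi>}"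
  have fS: "finite ?S" using finite_embeddings[OF finite_simple_graphD(1)[OF H], of n] by simp
  have fT: "finite ?T" by (simp add: finite_all_edges)
  have "codegree (all_edges {..<n}) (copy_weight H n) \<sigma> =
      (\<Sum>F\<in>?T. \<Sum>\<phi> | \<phi> \<in> ?S \<and> copy_edges H \<phi> = F. 1)"
    unfolding codegree_def copy_weight_def
    by (intro sum.cong refl) (auto intro!: arg_cong[where f = card])
  also have "\<dots> = (\<Sum>\<phi>\<in>?S. 1)"
    using copy_edges_subset[OF H] by (intro sum.group fS fT) auto
  finally show ?thesis by simp
qed

lemma card_Union_edges_le:
  assumes "finite F" "\<And>e. e \<in> F \<Longrightarrow> card e = 2"
  shows "card (\<Union>F) \<le> 2 * card F"
proof -
  have "card (\<Union>F) \<le> sum card F"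
    by (rule card_Union_le_sum_card)
  also have "\<dots> = 2 * card F" using assms by simp
  finally show ?thesis .
qed

text \<open>The vertices covered by \<open>F\<close> must be sent into
  \<open>\<Union>\<sigma>\<close>, which has at most \<open>2 * card (snd H)\<close> elements; every
  other vertex has at most \<open>n\<close> possible images.\<close>

lemma card_embeddings_fixing_le:
  assumes H: "finite_simple_graph H" and F: "F \<subseteq> snd H" and \<sigma>: "\<sigma> \<subseteq> all_edges {..<n}" "card \<sigma> = card F"
    "\<sigma> \<noteq> {}"
  shows "card {\<phi> \<in> embeddings H n. (\<lambda>e. \<phi> ` e) ` F = \<sigma>} \<le>
    (2 * card (snd H)) ^ card (fst H) * n ^ (card (fst H) - card (\<Union>F))"
proof -
  let ?A = "\<lambda>x. if x \<in> \<Union>F then \<Union>\<sigma> else {..<n}"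
  have VH: "finite (fst H)" and EH: "finite (snd H)" using finite_simple_graphD[OF H] by auto
  have UF: "\<Union>F \<subseteq> fst H" using F finite_simple_graphD(3)[OF H] by blast
  have fs: "finite \<sigma>" using \<sigma>(1) finite_all_edges finite_subset by blast
  have fU: "finite (\<Union>\<sigma>)"
    by (rule finite_subset[of _ "{..<n}"]) (use \<sigma>(1) in \<open>auto simp: all_edges_def\<close>)
  have "card (\<Union>\<sigma>) \<le> 2 * card \<sigma>"
    using \<sigma>(1) fs by (intro card_Union_edges_le) (auto simp: all_edges_def)
  also have "\<dots> \<le> 2 * card (snd H)" using \<sigma>(2) card_mono[OF EH F] by simp
  finally have U: "card (\<Union>\<sigma>) \<le> 2 * card (snd H)" .
  have pos: "1 \<le> 2 * card (snd H)"
    using \<sigma>(2,3) fs card_mono[OF EH F] by (metis One_nat_def Suc_leI card_gt_0_iff le_trans nat_0_less_mult_iff neq0_conv not_le zero_less_numeral)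
  have "card {\<phi> \<in> embeddings H n. (\<lambda>e. \<phi> ` e) ` F = \<sigma>} \<le> card (PiE (fst H) ?A)"
  proof (rule card_mono)
    show "finite (PiE (fst H) ?A)" using VH fU by (intro finite_PiE) auto
    show "{\<phi> \<in> embeddings H n. (\<lambda>e. \<phi> ` e) ` F = \<sigma>} \<subseteq> PiE (fst H) ?A"
    proof
      fix \<phi> assume \<phi>: "\<phi> \<in> {\<phi> \<in> embeddings H n. (\<lambda>e. \<phi> ` e) ` F = \<sigma>}"
      then have "\<phi> \<in> fst H \<rightarrow>\<^sub>E {..<n}" and im: "(\<lambda>e. \<phi> ` e) ` F = \<sigma>"
        by (auto simp: embeddings_def)
      moreover have "\<phi> x \<in> \<Union>\<sigma>" if "x \<in> \<Union>F" for x
        unfolding im[symmetric] using that by auto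
      ultimately show "\<phi> \<in> PiE (fst H) ?A" by (simp add: PiE_iff)
    qed
  qed
  also have "\<dots> = (\<Prod>x\<in>fst H. if x \<in> \<Union>F then card (\<Union>\<sigma>) else n)"
    using VH by (simp add: card_PiE if_distrib cong: if_cong)
  also have "\<dots> = card (\<Union>\<sigma>) ^ card (fst H \<inter> \<Union>F) * n ^ card (fst H - \<Union>F)"
    using VH by (simp only: prod.If_cases prod_constant Collect_mem_eq Diff_eq)
  also have "fst H \<inter> \<Union>F = \<Union>F" using UF by auto
  also have "card (fst H - \<Union>F) = card (fst H) - card (\<Union>F)"
    using UF VH finite_subset by (intro card_Diff_subset) auto
  also have "card (\<Union>\<sigma>) ^ card (\<Union>F) \<le> (2 * card (snd H)) ^ card (\<Union>F)"
    by (rule power_mono[OF U]) simp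
  also have "\<dots> \<le> (2 * card (snd H)) ^ card (fst H)"
    using pos card_mono[OF VH UF] by (intro power_increasing)
  finally show ?thesis by (simp add: mult_right_mono)
qed

section \<open>The density m_2 and the codegrees of copies\<close>

lemma d2_le_m2:
  assumes "finite_simple_graph H" "J \<in> subgraphs H" "card (fst J) \<ge> 3"
  shows "d2 J \<le> m2 H"
  unfolding m2_def
proof (rule Max_ge)
  have "subgraphs H \<subseteq> Pow (fst H) \<times> Pow (snd H)" by (auto simp: subgraphs_def)
  then have "finite (subgraphs H)"
    using finite_simple_graphD(1,2)[OF assms(1)] by (meson finite_Pow_iff finite_SigmaI finite_subset)
  then have "finite (d2 ` {J \<in> subgraphs H. 3 \<le> card (fst J)})" by simp
  then show "finite {d2 J | J. J \<in> subgraphs H \<and> 3 \<le> card (fst J)}"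
    by (simp only: setcompr_eq_image)
qed (use assms in blast)

text \<open>This is the maximum in \<open>m2 H\<close> tested on the subgraph spanned by
  \<open>F\<close>. If \<open>F\<close> spans just two vertices, where \<open>d2\<close> makes no
  sense, then \<open>F\<close> is a single edge and both sides vanish.\<close>

lemma edge_subset_m2_bound:
  assumes H: "finite_simple_graph H" and F: "F \<subseteq> snd H" "F \<noteq> {}"
  shows "2 \<le> card (\<Union>F)" "card F - 1 \<le> m2 H * (card (\<Union>F) - 2)"
proof -
  have sub: "\<Union>F \<subseteq> fst H" using F finite_simple_graphD(3)[OF H] by blast
  have fU: "finite (\<Union>F)" using sub finite_simple_graphD(1)[OF H] finite_subset by auto
  have edges: "F \<subseteq> all_edges (\<Union>F)"
    using F finite_simple_graphD(4)[OF H] by (auto simp: all_edges_def)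
  obtain e where e: "e \<in> F" using F by auto
  then have "card e = 2" using F finite_simple_graphD(4)[OF H] by auto
  then show u: "2 \<le> card (\<Union>F)" using card_mono[OF fU, of e] e by auto
  show "card F - 1 \<le> m2 H * (card (\<Union>F) - 2)"
  proof (cases "card (\<Union>F) = 2")
    case True
    have "card F \<le> card (all_edges (\<Union>F))" using edges fU finite_all_edges by (intro card_mono) auto
    also have "\<dots> = 1" using True fU by (simp add: card_all_edges)
    finally show ?thesis using True by simp
  next
    case False
    then have u3: "3 \<le> card (\<Union>F)" using u by simp
    have "(\<Union>F, F) \<in> subgraphs H" using F sub edges by (auto simp: subgraphs_def)
    from d2_le_m2[OF H this] u3 have "(real (card F) - 1) / (real (card (\<Union>F)) - 2) \<le> m2 H"
      by (simp add: d2_def)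
    moreover have "card F \<ge> 1"
      using e F finite_simple_graphD(2)[OF H] by (metis card_gt_0_iff finite_subset One_nat_def Suc_leI)
    ultimately show ?thesis using u3 by (simp add: pos_divide_le_eq of_nat_diff)
  qed
qed

text \<open>Two edges span at most four vertices. The bound makes n^(-1/m_2(H)) at least n^(-2), so
  that the intended fingerprint size does not tend to 0.\<close>

lemma m2_ge_half:
  assumes H: "finite_simple_graph H" and "card (snd H) \<ge> 2"
  shows "m2 H \<ge> 1 / 2"
proof -
  obtain F where F: "F \<subseteq> snd H" "card F = 2" using assms(2) by (metis obtain_subset_with_card_n)
  have fF: "finite F" "F \<noteq> {}" using F by (auto intro: card_ge_0_finite)
  have u: "2 \<le> card (\<Union>F)" "card F - 1 \<le> m2 H * (card (\<Union>F) - 2)"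
    using edge_subset_m2_bound[OF H F(1) fF(2)] by auto
  have "card (\<Union>F) \<le> 4"
    using card_Union_edges_le[of F] F fF finite_simple_graphD(4)[OF H] by fastforce
  then have "card (\<Union>F) - 2 = 0 \<or> card (\<Union>F) - 2 = 1 \<or> card (\<Union>F) - 2 = 2" by auto
  then show ?thesis using u(2) F(2) by auto
qed

text \<open>An embedding whose copy contains \<open>\<sigma>\<close> maps some \<open>F\<close> of
  the same size onto \<open>\<sigma>\<close>, and there are at most \<open>2 ^ card (snd H)\<close>
  choices of \<open>F\<close>. Each leaves about n^(v-u) embeddings, where u is the number of
  vertices of \<open>F\<close>; the definition of m_2 converts the missing n^(u-2) into powers of
  the threshold.\<close>

lemma card_embeddings_containing_le:
  assumes H: "finite_simple_graph H" and m2: "m2 H > 0" and n: "n \<ge> 1"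
    and \<sigma>: "\<sigma> \<subseteq> all_edges {..<n}" "\<sigma> \<noteq> {}"
  shows "real (card {\<phi> \<in> embeddings H n. \<sigma> \<subseteq> copy_edges H \<phi>}) \<le>
    2 ^ card (snd H) * ((2 * card (snd H)) ^ card (fst H) *
      (real n ^ (card (fst H) - 2) * (real n powr (- 1 / m2 H)) ^ (card \<sigma> - 1)))"
proof -
  let ?v = "card (fst H)" and ?e = "card (snd H)" and ?\<theta> = "real n powr (- 1 / m2 H)"
  let ?\<F> = "{F \<in> Pow (snd H). card F = card \<sigma>}"
  have VH: "finite (fst H)" and EH: "finite (snd H)" using finite_simple_graphD[OF H] by auto
  have fs: "finite \<sigma>" using \<sigma>(1) finite_all_edges[of "{..<n}"] finite_subset by blast
  have "{\<phi> \<in> embeddings H n. \<sigma> \<subseteq> copy_edges H \<phi>} \<subseteq>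
      (\<Union>F\<in>?\<F>. {\<phi> \<in> embeddings H n. (\<lambda>e. \<phi> ` e) ` F = \<sigma>})"
  proof
    fix \<phi> assume "\<phi> \<in> {\<phi> \<in> embeddings H n. \<sigma> \<subseteq> copy_edges H \<phi>}"
    then have \<phi>: "\<phi> \<in> embeddings H n" "\<sigma> \<subseteq> (\<lambda>e. \<phi> ` e) ` snd H" by (auto simp: copy_edges_def)
    then obtain F where F: "F \<subseteq> snd H" "\<sigma> = (\<lambda>e. \<phi> ` e) ` F" by (auto simp: subset_image_iff)
    have "inj_on (\<lambda>e. \<phi> ` e) F" by (rule inj_on_subset[OF inj_on_copy_edges[OF H \<phi>(1)] F(1)])
    then have "card F = card \<sigma>" using F by (simp add: card_image)
    then show "\<phi> \<in> (\<Union>F\<in>?\<F>. {\<phi> \<in> embeddings H n. (\<lambda>e. \<phi> ` e) ` F = \<sigma>})" using F \<phi> by auto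
  qed
  then have "card {\<phi> \<in> embeddings H n. \<sigma> \<subseteq> copy_edges H \<phi>} \<le>
      card (\<Union>F\<in>?\<F>. {\<phi> \<in> embeddings H n. (\<lambda>e. \<phi> ` e) ` F = \<sigma>})"
    using EH finite_embeddings[OF VH, of n] by (intro card_mono) auto
  also have "\<dots> \<le> (\<Sum>F\<in>?\<F>. card {\<phi> \<in> embeddings H n. (\<lambda>e. \<phi> ` e) ` F = \<sigma>})"
    using EH by (intro card_UN_le) auto
  finally have "real (card {\<phi> \<in> embeddings H n. \<sigma> \<subseteq> copy_edges H \<phi>}) \<le>
      (\<Sum>F\<in>?\<F>. real (card {\<phi> \<in> embeddings H n. (\<lambda>e. \<phi> ` e) ` F = \<sigma>}))"
    by (simp flip: of_nat_sum)
  also have "\<dots> \<le> (\<Sum>F\<in>?\<F>. (2 * ?e) ^ ?v * (real n ^ (?v - 2) * ?\<theta> ^ (card \<sigma> - 1)))"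
  proof (rule sum_mono)
    fix F assume "F \<in> ?\<F>"
    then have F: "F \<subseteq> snd H" "card F = card \<sigma>" by auto
    have "F \<noteq> {}" using F(2) \<sigma>(2) fs by auto
    note u = edge_subset_m2_bound[OF H F(1) this]
    have UF: "\<Union>F \<subseteq> fst H" using F(1) finite_simple_graphD(3)[OF H] by blast
    have uv: "card (\<Union>F) \<le> ?v" by (rule card_mono[OF VH UF])
    have "1 = real n powr 0" using n by simp
    \<comment> \<open>The exponent is nonnegative by \<open>edge_subset_m2_bound\<close>, divided by
      \<open>m2 H\<close>.\<close>
    also have "\<dots> \<le> real n powr (real (card (\<Union>F) - 2) + (- 1 / m2 H) * real (card \<sigma> - 1))"
      using n u(2) m2 F(2) by (intro powr_mono) (auto simp: field_simps)
    also have "\<dots> = real n ^ (card (\<Union>F) - 2) * ?\<theta> ^ (card \<sigma> - 1)"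
      using n by (subst powr_add) (simp add: powr_powr flip: powr_realpow)
    finally have one: "1 \<le> real n ^ (card (\<Union>F) - 2) * ?\<theta> ^ (card \<sigma> - 1)" .
    have "?v - 2 = (?v - card (\<Union>F)) + (card (\<Union>F) - 2)" using uv u(1) by simp
    then have "real n ^ (?v - 2) * ?\<theta> ^ (card \<sigma> - 1) =
        real n ^ (?v - card (\<Union>F)) * (real n ^ (card (\<Union>F) - 2) * ?\<theta> ^ (card \<sigma> - 1))"
      by (simp only: power_add mult.assoc)
    then have le: "real n ^ (?v - card (\<Union>F)) \<le> real n ^ (?v - 2) * ?\<theta> ^ (card \<sigma> - 1)"
      using mult_left_mono[OF one, of "real n ^ (?v - card (\<Union>F))"]
      by (simp only: mult_1_right zero_le_power of_nat_0_le_iff)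
    have "real (card {\<phi> \<in> embeddings H n. (\<lambda>e. \<phi> ` e) ` F = \<sigma>}) \<le>
        real ((2 * ?e) ^ ?v * n ^ (?v - card (\<Union>F)))"
      using card_embeddings_fixing_le[OF H F(1) \<sigma>(1) F(2)[symmetric] \<sigma>(2)] by (simp only: of_nat_le_iff)
    also have "\<dots> = (2 * ?e) ^ ?v * real n ^ (?v - card (\<Union>F))" by simp
    also have "\<dots> \<le> (2 * ?e) ^ ?v * (real n ^ (?v - 2) * ?\<theta> ^ (card \<sigma> - 1))"
      using le by (rule mult_left_mono) simp
    finally show "real (card {\<phi> \<in> embeddings H n. (\<lambda>e. \<phi> ` e) ` F = \<sigma>}) \<le>
        (2 * ?e) ^ ?v * (real n ^ (?v - 2) * ?\<theta> ^ (card \<sigma> - 1))" .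
  qed
  also have "\<dots> = card ?\<F> * ((2 * ?e) ^ ?v * (real n ^ (?v - 2) * ?\<theta> ^ (card \<sigma> - 1)))" by simp
  also have "\<dots> \<le> 2 ^ ?e * ((2 * ?e) ^ ?v * (real n ^ (?v - 2) * ?\<theta> ^ (card \<sigma> - 1)))"
  proof (rule mult_right_mono)
    have "card ?\<F> \<le> card (Pow (snd H))" using EH by (intro card_mono) auto
    then have "card ?\<F> \<le> 2 ^ ?e" using EH by (simp add: card_Pow)
    then show "real (card ?\<F>) \<le> 2 ^ ?e" by (metis of_nat_le_iff of_nat_numeral of_nat_power)
  qed simp
  finally show ?thesis .
qed

text \<open>There are at least (n/2)^v embeddings and at most n^2 pairs, so \<open>D\<close> is at
  least n^(v-2) / 2^v. The last factor of the constant compensates for this 2^v.\<close>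

lemma spread_copy_weight:
  fixes q :: real
  assumes H: "finite_simple_graph H" "card (snd H) \<ge> 2" and n: "n \<ge> 2" "n \<ge> 2 * card (fst H)"
    and q: "real n powr (- 1 / m2 H) \<le> q"
  defines "N \<equiv> real (card (all_edges {..<n}))"
  shows "spread (all_edges {..<n}) (copy_weight H n) (card (snd H))
    (2 ^ card (snd H) * (2 * card (snd H)) ^ card (fst H) * 2 ^ card (fst H))
    (card (embeddings H n) / N) q"
    and "card (embeddings H n) / N > 0"
proof -
  let ?v = "card (fst H)" and ?e = "card (snd H)" and ?\<theta> = "real n powr (- 1 / m2 H)"
  have N: "N > 0" "N \<le> real n ^ 2" using card_all_edges_bounds[OF n(1)] by (simp_all add: N_def)
  have VH: "finite (fst H)" by (rule finite_simple_graphD(1)[OF H(1)])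
  have "snd H \<noteq> {}" using H(2) by auto
  then obtain e where "e \<in> snd H" by auto
  then have v: "2 \<le> ?v"
    using finite_simple_graphD(3,4)[OF H(1), of e] card_mono[OF VH, of e] by simp
  have "real n ^ (?v - 2) / 2 ^ ?v = (real n / 2) ^ ?v / real n ^ 2"
    using v n(1) by (simp add: power_divide power_diff)
  also have "\<dots> \<le> card (embeddings H n) / real n ^ 2"
    using card_embeddings_ge[OF VH n(2)] by (intro divide_right_mono) auto
  also have "\<dots> \<le> card (embeddings H n) / N" using N n(1) by (intro divide_left_mono mult_pos_pos) auto
  finally have D: "real n ^ (?v - 2) / 2 ^ ?v \<le> card (embeddings H n) / N" .
  moreover have "real n ^ (?v - 2) / 2 ^ ?v > 0" using n by simp
  ultimately show "card (embeddings H n) / N > 0" by linarith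
  have m2: "m2 H > 0" using m2_ge_half[OF H] by simp
  show "spread (all_edges {..<n}) (copy_weight H n) ?e (2 ^ ?e * (2 * ?e) ^ ?v * 2 ^ ?v)
    (card (embeddings H n) / N) q"
    unfolding spread_def
  proof (intro conjI allI impI)
    fix F assume "copy_weight H n F \<noteq> 0"
    then obtain \<phi> where "\<phi> \<in> embeddings H n" "copy_edges H \<phi> = F"
      by (auto simp: copy_weight_def dest: card_gt_0_iff[THEN iffD1, rotated])
    then show "card F = ?e" using card_copy_edges[OF H(1)] by auto
  next
    show "codegree (all_edges {..<n}) (copy_weight H n) {} =
        card (embeddings H n) / N * real (card (all_edges {..<n}))"
      using N by (simp add: codegree_copy_weight[OF H(1)] N_def)
  next
    fix \<sigma> assume \<sigma>: "\<sigma> \<subseteq> all_edges {..<n}" "\<sigma> \<noteq> {}"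
    let ?j = "card \<sigma> - 1"
    have "codegree (all_edges {..<n}) (copy_weight H n) \<sigma> \<le>
        2 ^ ?e * ((2 * ?e) ^ ?v * (real n ^ (?v - 2) * ?\<theta> ^ ?j))"
      using card_embeddings_containing_le[OF H(1) m2 _ \<sigma>] n by (simp add: codegree_copy_weight[OF H(1)])
    also have "\<dots> = (2 ^ ?e * (2 * ?e) ^ ?v * 2 ^ ?v) * (?\<theta> ^ ?j * (real n ^ (?v - 2) / 2 ^ ?v))"
      by simp
    also have "\<dots> \<le> (2 ^ ?e * (2 * ?e) ^ ?v * 2 ^ ?v) * (q ^ ?j * (card (embeddings H n) / N))"
      using D q order_trans[OF powr_ge_zero q]
      by (intro mult_left_mono mult_mono power_mono) auto
    finally show "codegree (all_edges {..<n}) (copy_weight H n) \<sigma> \<le>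
        2 ^ ?e * (2 * ?e) ^ ?v * 2 ^ ?v * q ^ ?j * (card (embeddings H n) / N)" by (simp add: mult.assoc)
  qed (simp add: copy_weight_def)
qed

lemma edge_free_copy_weight:
  assumes H: "finite_simple_graph H" and I: "\<not> contains_copy H ({..<n}, I)"
  shows "edge_free (copy_weight H n) I"
  unfolding edge_free_def
proof (intro allI impI notI)
  fix F assume "copy_weight H n F \<noteq> 0" "F \<subseteq> I"
  then obtain \<phi> where \<phi>: "\<phi> \<in> embeddings H n" "copy_edges H \<phi> \<subseteq> I"
    by (auto simp: copy_weight_def dest: card_gt_0_iff[THEN iffD1, rotated])
  then have "contains_copy H ({..<n}, I)"
    unfolding contains_copy_def embeddings_def copy_edges_def by auto
  with I show False ..
qed

lemma containers_copies:
  assumes H: "finite_simple_graph H" "card (snd H) \<ge> 2"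
  shows "\<exists>\<delta>>0::real. \<delta> \<le> 1 \<and> (\<exists>A>0. \<forall>\<^sub>F n in sequentially. \<exists>t.
    real t \<le> A * m2_threshold H n * card (all_edges {..<n}) \<and>
    containers (all_edges {..<n}) {} (all_edges {..<n}) t ((1 - \<delta>) * card (all_edges {..<n}))
      (\<lambda>I. \<not> contains_copy H ({..<n}, I)))"
proof -
  let ?v = "card (fst H)" and ?e = "card (snd H)" and ?V = "\<lambda>n. all_edges {..<n :: nat}"
  define K :: real where "K = 2 ^ ?e * (2 * ?e) ^ ?v * 2 ^ ?v"
  have K: "K > 0" using H(2) by (simp add: K_def)
  obtain r where r: "?e = Suc r" using H(2) by (cases ?e) auto
  obtain \<delta> :: real where \<delta>: "\<delta> > 0" and cont: "\<forall>(V :: nat set set) m w (D :: real).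
      finite V \<and> V \<noteq> {} \<and> 0 < m \<and> real m \<le> \<delta> * card V \<and> D > 0 \<and>
      spread V w (Suc r) K D (real m / card V) \<longrightarrow>
      containers V {} V (Suc r * m) ((1 - \<delta>) * card V) (edge_free w)"
    using hypergraph_containers[OF K, of r] by (elim exE conjE)
  have m2: "m2 H \<ge> 1 / 2" by (rule m2_ge_half[OF H])
  have "((\<lambda>n. real n powr (- 1 / m2 H)) \<longlongrightarrow> 0) sequentially"
    using m2 by (intro tendsto_neg_powr filterlim_real_sequentially) auto
  then have "\<forall>\<^sub>F n in sequentially. real n powr (- 1 / m2 H) < \<delta> / 5"
    using \<delta> by (intro order_tendstoD) auto
  moreover have "\<forall>\<^sub>F n in sequentially. n \<ge> 2 + 2 * ?v" by (rule eventually_ge_at_top)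
  ultimately have "\<forall>\<^sub>F n in sequentially. \<exists>t.
    real t \<le> (5 * ?e) * m2_threshold H n * card (?V n) \<and>
    containers (?V n) {} (?V n) t ((1 - min \<delta> 1) * card (?V n))
      (\<lambda>I. \<not> contains_copy H ({..<n}, I))"
  proof eventually_elim
    case (elim n)
    let ?\<theta> = "real n powr (- 1 / m2 H)" and ?N = "real (card (?V n))"
    have n: "n \<ge> 2" "n \<ge> 2 * ?v" using elim by auto
    have N: "real n ^ 2 / 4 \<le> ?N" using card_all_edges_bounds[OF n(1)] by simp
    have N0: "?N > 0" using card_all_edges_bounds(3)[OF n(1)] by simp
    \<comment> \<open>Here \<open>m2 H \<ge> 1 / 2\<close> keeps \<open>?\<theta> * ?N\<close> away
      from 0, which is needed to absorb the rounding in \<open>m\<close>.\<close>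
    have "real n powr (- 2) \<le> ?\<theta>" using n m2 by (intro powr_mono) (auto simp: field_simps)
    then have "real n powr (- 2) * (real n ^ 2 / 4) \<le> ?\<theta> * ?N" using N by (intro mult_mono) auto
    moreover have "real n powr (- 2) = 1 / real n ^ 2" using n by (simp add: powr_minus_divide)
    ultimately have \<theta>N: "1 / 4 \<le> ?\<theta> * ?N" using n by simp
    \<comment> \<open>Rounding up makes \<open>m / ?N\<close> at least \<open>?\<theta>\<close>, as
      \<open>spread\<close> requires. The error of at most 1 is at most
      \<open>4 * ?\<theta> * ?N\<close>, whence the constant 5 here and in the earlier requirement
      \<open>?\<theta> < \<delta> / 5\<close>.\<close>
    define m where "m = nat \<lceil>?\<theta> * ?N\<rceil>"
    have m: "?\<theta> * ?N \<le> m" "real m \<le> ?\<theta> * ?N + 1" "0 < m"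
      using \<theta>N unfolding m_def by linarith+
    then have m5: "real m \<le> 5 * ?\<theta> * ?N" using \<theta>N by simp
    also have "\<dots> \<le> \<delta> * ?N" using elim(1) by (intro mult_right_mono) auto
    finally have m\<delta>: "real m \<le> \<delta> * ?N" .
    have q: "?\<theta> \<le> real m / ?N" using m(1) N0 by (simp add: pos_le_divide_eq)
    have "containers (?V n) {} (?V n) (Suc r * m) ((1 - \<delta>) * ?N) (edge_free (copy_weight H n))"
    proof (intro cont[rule_format] conjI)
      show "?V n \<noteq> {}" using N0 by auto
      show "card (embeddings H n) / ?N > 0" by (rule spread_copy_weight(2)[OF H n q])
      show "spread (?V n) (copy_weight H n) (Suc r) K (card (embeddings H n) / ?N) (real m / ?N)"
        using spread_copy_weight(1)[OF H n q] unfolding K_def r .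
    qed (use m(3) m\<delta> finite_all_edges in auto)
    then have "containers (?V n) {} (?V n) (0 + Suc r * m) ((1 - min \<delta> 1) * ?N)
        (\<lambda>I. \<not> contains_copy H ({..<n}, I))"
      by (rule containers_extend)
        (auto intro: edge_free_copy_weight[OF H(1)] mult_right_mono)
    moreover have "real (Suc r * m) \<le> (5 * ?e) * m2_threshold H n * ?N"
    proof -
      have "real (Suc r * m) = real (Suc r) * real m" by (rule of_nat_mult)
      also have "\<dots> \<le> real (Suc r) * (5 * ?\<theta> * ?N)" using m5 by (rule mult_left_mono) simp
      also have "\<dots> = (5 * ?e) * m2_threshold H n * ?N"
        using m2 unfolding r by (simp add: m2_threshold_def algebra_simps)
      finally show ?thesis .
    qed
    ultimately show ?case by (intro exI[of _ "Suc r * m"]) simp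
  qed
  then show ?thesis
    using \<delta> H(2) by (intro exI[of _ "min \<delta> 1"] conjI exI[of _ "5 * real ?e"]) auto
qed

text \<open>A bijection from the edge of \<open>H\<close> onto an edge of \<open>I\<close> extends
  by any injection of the other vertices. Hence only the empty set is free of copies, and the empty
  container with empty fingerprint works with \<open>\<delta> = 1\<close>, whatever the
  threshold.\<close>

lemma contains_copy_of_single_edge:
  assumes H: "finite_simple_graph H" and one: "card (snd H) \<le> 1" and n: "card (fst H) \<le> n"
    and I: "I \<subseteq> all_edges {..<n}" "I \<noteq> {}"
  shows "contains_copy H ({..<n}, I)"
proof -
  have VH: "finite (fst H)" and EH: "finite (snd H)" using finite_simple_graphD[OF H] by auto
  obtain f where f: "f \<in> I" using I by auto
  then have f2: "f \<subseteq> {..<n}" "card f = 2" using I by (auto simp: all_edges_def)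
  consider "snd H = {}" | e where "snd H = {e}"
    using one EH by (metis card_0_eq card_1_singletonE le_SucE le_zero_eq One_nat_def)
  then show ?thesis
  proof cases
    case 1
    obtain g where "g ` fst H \<subseteq> {..<n}" "inj_on g (fst H)"
      using card_le_inj[OF VH, of "{..<n}"] n by auto
    then show ?thesis using 1 by (auto simp: contains_copy_def)
  next
    case (2 e)
    then have e: "e \<subseteq> fst H" "card e = 2" using finite_simple_graphD(3,4)[OF H, of e] by auto
    have fin: "finite e" "finite f" using e f2 by (auto intro: card_ge_0_finite)
    obtain h where h: "bij_betw h e f" using finite_same_card_bij[OF fin] e f2 by auto
    have "card (fst H - e) \<le> card ({..<n} - f)"
      using e f2 fin n by (simp add: card_Diff_subset)
    then obtain g where g: "g ` (fst H - e) \<subseteq> {..<n} - f" "inj_on g (fst H - e)"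
      using card_le_inj[of "fst H - e" "{..<n} - f"] VH by auto
    define \<phi> where "\<phi> x = (if x \<in> e then h x else g x)" for x
    have im: "\<phi> ` e = f" using h by (auto simp: \<phi>_def bij_betw_def)
    have im2: "\<phi> ` (fst H - e) \<subseteq> {..<n} - f" using g by (auto simp: \<phi>_def)
    have "inj_on \<phi> e" using h by (auto simp: \<phi>_def bij_betw_def inj_on_def)
    moreover have "inj_on \<phi> (fst H - e)" using g by (auto simp: \<phi>_def inj_on_def)
    moreover have "\<phi> ` e \<inter> \<phi> ` (fst H - e) = {}" using im im2 by blast
    ultimately have "inj_on \<phi> (e \<union> (fst H - e))" by (subst inj_on_Un) blast
    moreover have un: "e \<union> (fst H - e) = fst H" using e by auto
    moreover have "\<phi> ` fst H \<subseteq> {..<n}" using im im2 f2 un by (metis image_Un Un_least Diff_subset order_trans)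
    ultimately show ?thesis
      unfolding contains_copy_def using 2 im f by (intro exI[of _ \<phi>]) auto
  qed
qed

lemma ex_containers_copies:
  assumes H: "finite_simple_graph H"
  shows "\<exists>\<delta>>0::real. \<delta> \<le> 1 \<and> (\<exists>A>0. \<forall>\<^sub>F n in sequentially. \<exists>t.
    real t \<le> A * m2_threshold H n * card (all_edges {..<n}) \<and>
    containers (all_edges {..<n}) {} (all_edges {..<n}) t ((1 - \<delta>) * card (all_edges {..<n}))
      (\<lambda>I. \<not> contains_copy H ({..<n}, I)))"
proof (cases "card (snd H) \<ge> 2")
  case True
  then show ?thesis by (rule containers_copies[OF H])
next
  case False
  have "\<forall>\<^sub>F n in sequentially. n \<ge> card (fst H)" by (rule eventually_ge_at_top)
  then have "\<forall>\<^sub>F n in sequentially. \<exists>t.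
    real t \<le> 1 * m2_threshold H n * card (all_edges {..<n}) \<and>
    containers (all_edges {..<n}) {} (all_edges {..<n}) t ((1 - 1 :: real) * card (all_edges {..<n}))
      (\<lambda>I. \<not> contains_copy H ({..<n}, I))"
  proof eventually_elim
    case (elim n)
    have "containers (all_edges {..<n}) {} (all_edges {..<n}) 0 ((1 - 1 :: real) * card (all_edges {..<n}))
      (\<lambda>I. \<not> contains_copy H ({..<n}, I))"
      using contains_copy_of_single_edge[OF H _ elim] False
      by (intro containers_const[where B = "{}"]) auto
    then show ?case by (intro exI[of _ 0]) (simp add: m2_threshold_def)
  qed
  then show ?thesis by (intro exI[of _ 1] conjI) auto
qed

section \<open>Choice of the constants\<close>

theorem theorem15:
  fixes H :: "'a graph"
  assumes "finite_simple_graph H" and "card (fst H) \<ge> 3"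
  shows "\<exists>C > 0. \<exists>\<gamma> > 0. \<exists>c > 0. \<forall>\<^sub>F n in sequentially.
    \<forall>p :: real. 0 \<le> p \<and> p \<le> 1 \<and> p \<ge> C * m2_threshold H n \<longrightarrow>
      measure_pmf.prob (Gnp n p)
        {G. \<forall>R \<subseteq> snd G. real (card R) \<le> \<gamma> * real n ^ 2 * p \<longrightarrow>
              maker_wins_H_game H (fst G, snd G - R)}
      \<ge> 1 - exp (- c * real n ^ 2 * p)"
proof -
  obtain \<delta> A :: real where \<delta>: "0 < \<delta>" "\<delta> \<le> 1" and A: "A > 0"
    and ev: "\<forall>\<^sub>F n in sequentially. \<exists>t. real t \<le> A * m2_threshold H n * card (all_edges {..<n}) \<and>
      containers (all_edges {..<n}) {} (all_edges {..<n}) t ((1 - \<delta>) * card (all_edges {..<n}))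
        (\<lambda>I. \<not> contains_copy H ({..<n}, I))"
    using ex_containers_copies[OF assms(1)] by blast
  have ln: "ln (16 / \<delta>) > 0" using \<delta> by simp
  \<comment> \<open>The first bound keeps fingerprints below half of what a container misses; the
    second makes their number, weighted by \<open>p ^ card T\<close>, negligible in the first
    moment.\<close>
  define \<epsilon> where "\<epsilon> = min (\<delta> / 2) (\<delta> / 16 / ln (16 / \<delta>))"
  have \<epsilon>0: "\<epsilon> > 0" using \<delta> ln by (simp add: \<epsilon>_def)
  have "\<epsilon> \<le> \<delta> / 16 / ln (16 / \<delta>)" by (simp add: \<epsilon>_def)
  then have "\<epsilon> * ln (16 / \<delta>) \<le> \<delta> / 16" using ln by (simp only: pos_le_divide_eq)
  moreover have "0 \<le> \<epsilon>" "\<epsilon> \<le> \<delta> / 2" using \<epsilon>0 by (auto simp: \<epsilon>_def)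
  ultimately have \<epsilon>: "0 \<le> \<epsilon>" "\<epsilon> \<le> \<delta> / 2" "\<epsilon> * ln (16 / \<delta>) \<le> \<delta> / 16" by auto
  have "\<forall>\<^sub>F n in sequentially. n \<ge> (2 :: nat)" by (rule eventually_ge_at_top)
  with ev have "\<forall>\<^sub>F n in sequentially.
    \<forall>p :: real. 0 \<le> p \<and> p \<le> 1 \<and> p \<ge> A / \<epsilon> * m2_threshold H n \<longrightarrow>
      measure_pmf.prob (Gnp n p)
        {G. \<forall>R \<subseteq> snd G. real (card R) \<le> \<delta> / 64 * real n ^ 2 * p \<longrightarrow>
              maker_wins_H_game H (fst G, snd G - R)}
      \<ge> 1 - exp (- (\<delta> / 64) * real n ^ 2 * p)"
  proof eventually_elim
    case (elim n)
    obtain t where t: "real t \<le> A * m2_threshold H n * card (all_edges {..<n})"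
      "containers (all_edges {..<n}) {} (all_edges {..<n}) t ((1 - \<delta>) * card (all_edges {..<n}))
        (\<lambda>I. \<not> contains_copy H ({..<n}, I))"
      using elim(1) by (elim exE conjE)
    show ?case
    proof (intro allI impI, elim conjE)
      fix p :: real assume p: "0 \<le> p" "p \<le> 1" "A / \<epsilon> * m2_threshold H n \<le> p"
      \<comment> \<open>The constant \<open>A / \<epsilon>\<close> in front of the threshold is what
        turns the fingerprint bound into \<open>\<epsilon>\<close> times the expected number of
        edges.\<close>
      have "A * m2_threshold H n \<le> \<epsilon> * p" using p(3) \<epsilon>0 by (simp add: field_simps)
      then have "A * m2_threshold H n * card (all_edges {..<n}) \<le> \<epsilon> * p * card (all_edges {..<n})"
        by (rule mult_right_mono) simp
      then have "real t \<le> \<epsilon> * card (all_edges {..<n}) * p" using t(1) by (simp add: mult_ac)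
      from prob_maker_wins[OF elim(2) p(1,2) \<delta> t(2) this \<epsilon>]
      show "measure_pmf.prob (Gnp n p)
        {G. \<forall>R \<subseteq> snd G. real (card R) \<le> \<delta> / 64 * real n ^ 2 * p \<longrightarrow>
              maker_wins_H_game H (fst G, snd G - R)}
        \<ge> 1 - exp (- (\<delta> / 64) * real n ^ 2 * p)" .
    qed
  qed
  then show ?thesis
    using \<delta> A \<epsilon>0 by (intro exI[of _ "A / \<epsilon>"] exI[of _ "\<delta> / 64"] conjI) auto
qed

end
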